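(* Let $\nu$ be a complex number and let $\mu$ be a real number with $\mu<\frac32$. Then, for every real $z\ge 0$, $$D_{-\nu}(z)D_{\mu-\nu-1}(z)=\frac{1}{\Gamma(\nu)}\sum_{n=0}^{+\infty}\frac{(-1)^n D_n(z)D_{\mu+n-1}(z)}{n!\,(n+\nu)}.$$
   Context: $D_\nu$ is the parabolic cylinder function, the entire function of $z\in\mathbb{C}$ (and of $\nu\in\mathbb{C}$) defined by $$D_\nu(z)=2^{\nu/2}e^{-z^2/4}\left(\frac{\sqrt{\pi}}{\Gamma(\frac12-\frac{\nu}{2})}\Phi\left(-\tfrac{\nu}{2},\tfrac12;\tfrac{z^2}{2}\right)-\frac{\sqrt{2\pi}\,z}{\Gamma(-\frac{\nu}{2})}\Phi\left(\tfrac12-\tfrac{\nu}{2},\tfrac32;\tfrac{z^2}{2}\right)\right),$$ with $1/\Gamma$ taken to be $0$ at the poles of $\Gamma$, where $\Phi(\nu,\mu;z)=\sum_{n=0}^{\infty}\frac{(\nu)_n}{(\mu)_n}\frac{z^n}{n!}$ is Kummer's confluent hypergeometric function and $(\nu)_n=\nu(\nu+1)\cdots(\nu+n-1)$. When $\nu$ is a nonpositive integer, each coefficient $\frac{1}{\Gamma(\nu)(n+\nu)}$ is read as its limiting value in $\nu$. *)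

theory Defs
  imports "HOL-Analysis.Analysis"
begin

definition kummer_Phi :: "complex \<Rightarrow> complex \<Rightarrow> complex \<Rightarrow> complex" where
  "kummer_Phi a b z = (\<Sum>n. pochhammer a n / pochhammer b n * (z ^ n / fact n))"

text \<open>\<^const>\<open>rGamma\<close> is the entire reciprocal Gamma function, so it vanishes at the poles of
  \<^const>\<open>Gamma\<close>.\<close>

definition parabolic_cylinder_D :: "complex \<Rightarrow> complex \<Rightarrow> complex" where
  "parabolic_cylinder_D \<nu> z =
     2 powr (\<nu> / 2) * exp (- (z ^ 2) / 4) *
       (of_real (sqrt pi) * rGamma (1 / 2 - \<nu> / 2) * kummer_Phi (- \<nu> / 2) (1 / 2) (z ^ 2 / 2)
        - of_real (sqrt (2 * pi)) * z * rGamma (- \<nu> / 2)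
            * kummer_Phi (1 / 2 - \<nu> / 2) (3 / 2) (z ^ 2 / 2))"

text \<open>The coefficient \<open>1 / (\<Gamma>(\<nu>) (n + \<nu>))\<close>. At nonpositive integers \<open>\<nu>\<close> the limit over the punctured
  neighbourhood is taken, because the division convention \<open>x / 0 = 0\<close> would give the wrong value
  for \<open>n = -\<nu>\<close>.\<close>

definition Gamma_coeff :: "complex \<Rightarrow> nat \<Rightarrow> complex" where
  "Gamma_coeff \<nu> n =
     (if \<nu> \<in> \<int>\<^sub>\<le>\<^sub>0 then Lim (at \<nu>) (\<lambda>w. 1 / (Gamma w * (of_nat n + w)))
      else 1 / (Gamma \<nu> * (of_nat n + \<nu>)))"

end

theory Submission
  imports Defs "HOL-Complex_Analysis.Complex_Analysis" "HOL-Real_Asymp.Real_Asymp"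
begin

text \<open>Separate the two arguments: for \<open>z, y \<ge> 0\<close> let
  \<open>A\<^sub>n(b) = (-1)\<^sup>n D\<^sub>n(z) D\<^bsub>b+n\<^esub>(y) / n!\<close> with \<open>b = \<mu> - 1\<close>, and put
  \<open>G = \<Sum>\<^sub>n A\<^sub>n(b)\<close>, \<open>T = \<Sum>\<^sub>n A\<^sub>n(b) / (n + \<nu>)\<close>.
  The energy \<open>|D'|\<^sup>2 + (b + 1/2 - x\<^sup>2/4) |D|\<^sup>2\<close> of \<open>D = D\<^sub>b\<close> decreases on the half line, so the values at 0
  bound \<open>D\<close> by the right power of \<open>n\<close>, pointwise as well as (with some loss) uniformly.

  For very negative \<open>b\<close> everything may be differentiated termwise. The recurrences of \<open>D\<close> give
  \<open>\<partial>G/\<partial>y = (y/2 - (b + 1)/(y + z)) G\<close>, whose nonzero solutions are unbounded, so \<open>G = 0\<close>. Hence \<open>T\<close> satisfies in \<open>z\<close>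
  the equation of \<open>D\<^bsub>-\<nu>\<^esub>\<close> and in \<open>y\<close> that of \<open>D\<^bsub>b-\<nu>\<^esub>\<close>. If also \<open>Re \<nu> > 1\<close>, a bounded solution of either equation is determined by
  its value at 0, because the squared modulus of a solution is convex, so \<open>T\<close> is a constant multiple
  of \<open>D\<^bsub>-\<nu>\<^esub>(z) D\<^bsub>b-\<nu>\<^esub>(y)\<close>; the constant is a Gauss sum at \<open>z = y = 0\<close>. The recurrences then carry the identity
  up in \<open>b\<close> and down in \<open>\<nu>\<close>.\<close>

section \<open>Power series and recurrences\<close>

text \<open>On the diagonal y = z only a product of two solutions is visible, and in general it
  obeys no second order equation; with separate arguments each factor is pinned down by a Weber
  equation of its own. The obstacle is convergence. Weber's equation costs a factor n, and the bound
  uniform in the argument is worse than the pointwise one by a full power of n, because the energy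
  loses its grip on D at the turning point 2 sqrt(b + n + 1/2), which moves away with n. With these
  bounds the termwise calculus works exactly for b < -5. After that no series is differentiated. The
  extension to larger b and smaller Re \<nu> rests on G = 0, which holds for b < -1: when a
  recurrence of the terms is divided by n + \<nu>, the part of its coefficient divisible by n +
  \<nu> leaves a multiple of G and disappears. At the poles of Gamma no limit of the series is
  taken, since a single coefficient survives there.\<close>

lemma Re_pos_not_nonpos_Int: "Re z > 0 \<Longrightarrow> z \<notin> \<int>\<^sub>\<le>\<^sub>0"
  by (auto elim!: nonpos_Ints_cases)

lemma summable_kummer:
  fixes a b w :: complex
  assumes b: "b \<notin> \<int>\<^sub>\<le>\<^sub>0"
  shows "summable (\<lambda>n. pochhammer a n / pochhammer b n * (w ^ n / fact n))"
proof -
  define f where "f = (\<lambda>n. pochhammer a n / pochhammer b n * (w ^ n / fact n))"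
  have bn: "b + of_nat n \<noteq> 0" for n
    using b plus_of_nat_eq_0_imp by blast
  have "(\<lambda>n. norm ((a + of_nat n) / (b + of_nat n) * (w / of_nat (Suc n)))) \<longlonglongrightarrow> 0"
  proof -
    have 1: "(\<lambda>n. (a / of_nat n + 1) / (b / of_nat n + 1)) \<longlonglongrightarrow> (0 + 1) / (0 + 1)"
      by (intro tendsto_intros lim_const_over_n) auto
    have "\<forall>\<^sub>F n in sequentially. (a / of_nat n + 1) / (b / of_nat n + 1) = (a + of_nat n) / (b + of_nat n)"
      using eventually_gt_at_top[of "0::nat"]
    proof eventually_elim
      case (elim n)
      have "(a / of_nat n + 1) / (b / of_nat n + 1)
             = ((a + of_nat n) / of_nat n) / ((b + of_nat n) / of_nat n)"
        using elim by (simp add: add_divide_distrib)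
      also have "\<dots> = (a + of_nat n) / (b + of_nat n)" using elim by simp
      finally show ?case .
    qed
    from tendsto_cong[OF this] 1 have 2: "(\<lambda>n. (a + of_nat n) / (b + of_nat n)) \<longlonglongrightarrow> 1" by simp
    have 3: "(\<lambda>n. w / of_nat (Suc n)) \<longlonglongrightarrow> 0"
      by (rule LIMSEQ_Suc[OF lim_const_over_n])
    from tendsto_norm[OF tendsto_mult[OF 2 3]] show ?thesis by (simp only: mult_zero_right norm_zero)
  qed
  then have "\<forall>\<^sub>F n in sequentially. norm ((a + of_nat n) / (b + of_nat n) * (w / of_nat (Suc n))) < 1/2"
    by (rule order_tendstoD) auto
  then obtain N where N: "\<And>n. n \<ge> N \<Longrightarrow> norm ((a + of_nat n) / (b + of_nat n) * (w / of_nat (Suc n))) < 1/2"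
    by (auto simp: eventually_at_top_linorder)
  have "summable f"
  proof (rule summable_ratio_test)
    show "(1/2::real) < 1" by simp
    fix n assume "n \<ge> N"
    have "f (Suc n) = (a + of_nat n) / (b + of_nat n) * (w / of_nat (Suc n)) * f n"
      unfolding f_def pochhammer_Suc fact_Suc power_Suc using bn[of n] by (simp add: mult_ac)
    then have "norm (f (Suc n)) = norm ((a + of_nat n) / (b + of_nat n) * (w / of_nat (Suc n))) * norm (f n)"
      by (simp only: norm_mult)
    also have "\<dots> \<le> 1/2 * norm (f n)"
      using N[OF \<open>n \<ge> N\<close>] by (intro mult_right_mono) simp_all
    finally show "norm (f (Suc n)) \<le> 1/2 * norm (f n)" .
  qed
  then show ?thesis by (simp add: f_def)
qed

lemma sums_interleave:
  fixes f g :: "nat \<Rightarrow> complex"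
  assumes "g sums x" "f sums y"
  shows "(\<lambda>n. if even n then f (n div 2) else g ((n - 1) div 2)) sums (x + y)"
proof -
  have "(\<lambda>n. if even n then Re (f (n div 2)) else Re (g ((n - 1) div 2))) sums (Re x + Re y)"
       "(\<lambda>n. if even n then Im (f (n div 2)) else Im (g ((n - 1) div 2))) sums (Im x + Im y)"
    using assms by (intro sums_if; simp add: sums_complex_iff)+
  then show ?thesis by (simp add: sums_complex_iff if_distrib cong: if_cong)
qed

text \<open>The Taylor coefficients of \<open>exp (z\<^sup>2 / 4) D\<^sub>a(z)\<close>.\<close>

definition hcoef :: "complex \<Rightarrow> nat \<Rightarrow> complex" where
  "hcoef a n = 2 powr (a / 2) / (2 ^ (n div 2) * fact (n div 2)) *
     (if even n then of_real (sqrt pi) * rGamma (1/2 - a/2)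
                     * (pochhammer (-a/2) (n div 2) / pochhammer (1/2) (n div 2))
      else - (of_real (sqrt (2 * pi)) * rGamma (-a/2)
                     * (pochhammer (1/2 - a/2) (n div 2) / pochhammer (3/2) (n div 2))))"

lemma half_not_nonpos_Int: "(1/2 :: complex) \<notin> \<int>\<^sub>\<le>\<^sub>0" "(3/2 :: complex) \<notin> \<int>\<^sub>\<le>\<^sub>0"
  by (auto elim!: nonpos_Ints_cases simp: complex_eq_iff)

lemma hcoef_even:
  "hcoef a (2 * k) = 2 powr (a / 2) * of_real (sqrt pi) * rGamma (1/2 - a/2) * pochhammer (-a/2) k
      / (pochhammer (1/2) k * 2 ^ k * fact k)"
  by (simp add: hcoef_def mult_ac)

lemma hcoef_odd:
  "hcoef a (Suc (2 * k)) = - (2 powr (a / 2) * of_real (sqrt (2 * pi)) * rGamma (-a/2) * pochhammer (1/2 - a/2) k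
      / (pochhammer (3/2) k * 2 ^ k * fact k))"
  by (simp add: hcoef_def mult_ac)

lemma hcoef_sums:
  "(\<lambda>n. hcoef a n * z ^ n) sums (exp (z ^ 2 / 4) * parabolic_cylinder_D a z)"
proof -
  define A where "A = 2 powr (a/2) * of_real (sqrt pi) * rGamma (1/2 - a/2)"
  define B where "B = - (2 powr (a/2) * of_real (sqrt (2 * pi)) * z * rGamma (-a/2))"
  have 1: "(\<lambda>n. A * (pochhammer (-a/2) n / pochhammer (1/2) n * ((z^2/2) ^ n / fact n)))
             sums (A * kummer_Phi (-a/2) (1/2) (z^2/2))"
    unfolding kummer_Phi_def by (intro sums_mult summable_sums summable_kummer half_not_nonpos_Int)
  have 2: "(\<lambda>n. B * (pochhammer (1/2-a/2) n / pochhammer (3/2) n * ((z^2/2) ^ n / fact n)))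
             sums (B * kummer_Phi (1/2-a/2) (3/2) (z^2/2))"
    unfolding kummer_Phi_def by (intro sums_mult summable_sums summable_kummer half_not_nonpos_Int)
  have "(\<lambda>n. if even n then
              A * (pochhammer (-a/2) (n div 2) / pochhammer (1/2) (n div 2) * ((z^2/2) ^ (n div 2) / fact (n div 2)))
            else B * (pochhammer (1/2-a/2) ((n-1) div 2) / pochhammer (3/2) ((n-1) div 2) * ((z^2/2) ^ ((n-1) div 2) / fact ((n-1) div 2))))
        = (\<lambda>n. hcoef a n * z ^ n)"
  proof
    fix n show "(if even n then
              A * (pochhammer (-a/2) (n div 2) / pochhammer (1/2) (n div 2) * ((z^2/2) ^ (n div 2) / fact (n div 2)))
            else B * (pochhammer (1/2-a/2) ((n-1) div 2) / pochhammer (3/2) ((n-1) div 2) * ((z^2/2) ^ ((n-1) div 2) / fact ((n-1) div 2))))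
        = hcoef a n * z ^ n"
    proof (cases "even n")
      case True
      then obtain k where "n = 2 * k" by auto
      then show ?thesis unfolding \<open>n = 2 * k\<close> hcoef_even A_def power_mult by (simp add: power_divide mult_ac)
    next
      case False
      then obtain k where "n = 2 * k + 1" by (auto elim: oddE)
      then show ?thesis unfolding \<open>n = 2 * k + 1\<close> Suc_eq_plus1[symmetric] hcoef_odd B_def power_Suc power_mult by (simp add: power_divide mult_ac)
    qed
  qed
  with sums_interleave[OF 2 1] have "(\<lambda>n. hcoef a n * z ^ n) sums
     (B * kummer_Phi (1/2-a/2) (3/2) (z^2/2) + A * kummer_Phi (-a/2) (1/2) (z^2/2))" by simp
  moreover have "exp (z\<^sup>2 / 4) * exp (- (z\<^sup>2) / 4) = 1"
    by (simp flip: exp_add)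
  then have "exp (z\<^sup>2 / 4) * (exp (- (z\<^sup>2) / 4) * w) = w" for w
    by (metis mult.assoc mult_1)
  moreover have "parabolic_cylinder_D a z = exp (- (z\<^sup>2) / 4) *
        (B * kummer_Phi (1/2-a/2) (3/2) (z^2/2) + A * kummer_Phi (-a/2) (1/2) (z^2/2))"
    unfolding parabolic_cylinder_D_def A_def B_def by (simp add: algebra_simps)
  ultimately show ?thesis by (simp only:)
qed

lemma two_powr_half_shift: "(2::complex) powr (a/2) = 2 powr ((a - 1)/2) * of_real (sqrt 2)"
proof -
  have "(2::complex) powr (a/2) = 2 powr ((a - 1)/2 + 1/2)" by (simp add: diff_divide_distrib)
  also have "\<dots> = 2 powr ((a - 1)/2) * 2 powr (of_real (1/2))" by (simp only: powr_add) simp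
  also have "(2::complex) powr (of_real (1/2)) = of_real (sqrt 2)"
    using powr_of_real[of 2 "1/2"] by (simp add: powr_half_sqrt)
  finally show ?thesis .
qed

text \<open>Coefficient form of (exp(z^2/4) D_a)' = a exp(z^2/4) D_(a-1). Differentiation
  interchanges the two Kummer series, so the parities need separate computations.\<close>

lemma hcoef_Suc: "of_nat (Suc n) * hcoef a (Suc n) = a * hcoef (a - 1) n"
proof (cases "even n")
  case True
  then obtain k where n: "n = 2 * k" by auto
  have r: "rGamma (-a/2) = -a/2 * rGamma (1 - a/2)"
    using rGamma_plus1[of "-a/2"] by simp
  have p: "pochhammer (3/2) k * (1/2) = pochhammer (1/2::complex) k * (1/2 + of_nat k)"
    using pochhammer_rec[of "1/2::complex" k] pochhammer_rec'[of "1/2::complex" k] by (simp add: mult.commute)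
  have nz: "pochhammer (1/2::complex) k \<noteq> 0" "pochhammer (3/2::complex) k \<noteq> 0"
    using half_not_nonpos_Int by (auto dest: pochhammer_eq_0_imp_nonpos_Int)
  have p': "(2 * of_nat k + 1) / pochhammer (3/2::complex) k = 1 / pochhammer (1/2) k"
    using p nz by (simp add: field_simps)
  have e: "1/2 - (a-1)/2 = 1 - a/2" "- (a - 1)/2 = 1/2 - a/2" by (simp_all add: field_simps)
  have s: "complex_of_real (sqrt 2) * of_real (sqrt 2) = 2"
    by (simp flip: of_real_mult)
  have "of_nat (Suc n) * hcoef a (Suc n) =
     a/2 * 2 powr ((a-1)/2) * (of_real (sqrt 2) * of_real (sqrt 2)) * of_real (sqrt pi)
       / (2^k * fact k) * rGamma (1-a/2) * pochhammer (1/2-a/2) k * ((2 * of_nat k + 1) / pochhammer (3/2) k)"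
    unfolding n hcoef_odd r two_powr_half_shift[of a] by (simp add: real_sqrt_mult mult_ac add_ac)
  also have "\<dots> = a * hcoef (a - 1) n"
    unfolding p' s n hcoef_even e by (simp add: mult_ac)
  finally show ?thesis .
next
  case False
  then obtain k where n: "n = 2 * k + 1" by (auto elim: oddE)
  have p: "pochhammer (-a/2) (Suc k) = -a/2 * pochhammer (1-a/2) k"
          "pochhammer (1/2::complex) (Suc k) = 1/2 * pochhammer (3/2) k"
    using pochhammer_rec[of "-a/2" k] pochhammer_rec[of "1/2::complex" k] by simp_all
  have e: "- (a - 1)/2 = 1/2 - a/2" "1/2 - (a-1)/2 = 1 - a/2" by (simp_all add: field_simps)
  have nz: "1 + of_nat k \<noteq> (0::complex)"
    by (metis of_nat_Suc of_nat_neq_0)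
  have S: "Suc n = 2 * Suc k" "n = Suc (2 * k)" using n by simp_all
  have c: "2 * K * (U * V * G * (- a / 2 * P) / (1/2 * Q * (2 * W) * (K * F))) = - (a * (U * V * G * P / (Q * W * F)))"
    if "K \<noteq> 0" for U V G P Q W F K :: complex using that by (simp add: mult_ac)
  have "of_nat (Suc n) * hcoef a (Suc n) = - (a * (2 powr (a/2) * of_real (sqrt pi) * rGamma (1/2-a/2) * pochhammer (1-a/2) k
     / (pochhammer (3/2) k * 2 ^ k * fact k)))"
    unfolding S(1) hcoef_even p fact_Suc power_Suc of_nat_mult of_nat_Suc using c[OF nz] by simp
  also have "\<dots> = a * hcoef (a - 1) n"
    unfolding S(2) hcoef_odd two_powr_half_shift[of a] e by (simp add: real_sqrt_mult mult_ac)
  finally show ?thesis .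
qed

text \<open>In terms of D this is D_(a+1)(0) = - D_a'(0), which supplies the index 0 of the
  three-term recurrence.\<close>

lemma hcoef_0_plus1: "hcoef (a + 1) 0 = - hcoef a 1"
proof -
  have "hcoef (a + 1) 0 = 2 powr ((a + 1)/2) * of_real (sqrt pi) * rGamma (-a/2)"
    by (simp add: hcoef_def add_divide_distrib diff_divide_distrib)
  also have "\<dots> = - hcoef a 1"
    using two_powr_half_shift[of "a + 1"] by (simp add: hcoef_def real_sqrt_mult)
  finally show ?thesis .
qed

text \<open>Coefficient form of Hermite's equation h'' - z h' + a h = 0 for h = exp(z^2/4) D_a. A
  step by two indices stays within one of the two Kummer series.\<close>

lemma hcoef_Suc_Suc:
  "of_nat (Suc (Suc m)) * of_nat (Suc m) * hcoef a (Suc (Suc m)) = (of_nat m - a) * hcoef a m"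
proof (cases "even m")
  case True
  then obtain k where m: "m = 2 * k" by auto
  have nz: "1 + of_nat k \<noteq> (0::complex)" "1/2 + of_nat k \<noteq> (0::complex)"
    using half_not_nonpos_Int plus_of_nat_eq_0_imp[of "1/2::complex" k]
    by (metis of_nat_Suc of_nat_neq_0, blast)
  define R where "R = 2 powr (a/2) / (2 ^ k * fact k) * of_real (sqrt pi) * rGamma (1/2-a/2) * pochhammer (-a/2) k / pochhammer (1/2) k"
  have h1: "hcoef a (Suc (Suc m)) = R * (-a/2 + of_nat k) / ((1/2 + of_nat k) * (2 * (1 + of_nat k)))"
    using m hcoef_even[of a "Suc k"] by (simp add: R_def pochhammer_Suc mult_ac algebra_simps(1-2))
  have h2: "hcoef a m = R" unfolding m hcoef_even by (simp add: R_def mult_ac)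
  have f: "of_nat (Suc (Suc m)) = 2 * (1 + of_nat k :: complex)" "of_nat (Suc m) = 2 * (1/2 + of_nat k :: complex)"
    "of_nat m - a = 2 * (- a/2 + of_nat k)"
    using m by (simp_all add: algebra_simps)
  have g: "2 * X * (2 * Y) * (R * W / (Y * (2 * X))) = 2 * W * R" if "X \<noteq> 0" "Y \<noteq> 0" for X Y W :: complex
    using that by simp
  show ?thesis unfolding h1 h2 f using nz by (intro g)
next
  case False
  then obtain k where m: "m = 2 * k + 1" by (auto elim: oddE)
  have nz: "1 + of_nat k \<noteq> (0::complex)" "3/2 + of_nat k \<noteq> (0::complex)"
    using half_not_nonpos_Int plus_of_nat_eq_0_imp[of "3/2::complex" k]
    by (metis of_nat_Suc of_nat_neq_0, blast)
  define R where "R = - (2 powr (a/2) / (2 ^ k * fact k) * of_real (sqrt (2*pi)) * rGamma (-a/2) * pochhammer (1/2-a/2) k / pochhammer (3/2) k)"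
  have h1: "hcoef a (Suc (Suc m)) = R * (1/2-a/2 + of_nat k) / ((3/2 + of_nat k) * (2 * (1 + of_nat k)))"
    using m hcoef_odd[of a "Suc k"] by (simp add: R_def pochhammer_Suc mult_ac algebra_simps(1-2))
  have h2: "hcoef a m = R" unfolding m Suc_eq_plus1[symmetric] hcoef_odd by (simp add: R_def mult_ac)
  have f: "of_nat (Suc (Suc m)) = 2 * (3/2 + of_nat k :: complex)" "of_nat (Suc m) = 2 * (1 + of_nat k :: complex)"
    "of_nat m - a = 2 * (1/2 - a/2 + of_nat k)"
    using m by (simp_all add: algebra_simps)
  have g: "2 * Y * (2 * X) * (R * W / (Y * (2 * X))) = 2 * W * R" if "X \<noteq> 0" "Y \<noteq> 0" for X Y W :: complex
    using that by simp
  show ?thesis unfolding h1 h2 f using nz by (intro g)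
qed

text \<open>After multiplication by n = m + 1 every term is a multiple of \<open>hcoef a m\<close>,
  and the claim becomes a + 1 = (m + 1) - (m - a). The order a - 1 is reached by going up to the
  index m + 2 and down again by Hermite's recursion.\<close>

lemma hcoef_plus1:
  "hcoef (a + 1) n = (if n = 0 then 0 else hcoef a (n - 1)) - a * hcoef (a - 1) n"
proof (cases n)
  case 0
  then show ?thesis using hcoef_Suc[of 0 a] by (simp add: hcoef_0_plus1)
next
  case (Suc m)
  have 1: "of_nat (Suc m) * hcoef (a + 1) (Suc m) = (a + 1) * hcoef a m"
    using hcoef_Suc[of m "a + 1"] by simp
  have 2: "of_nat (Suc m) * (a * hcoef (a - 1) (Suc m)) = (of_nat m - a) * hcoef a m"
    unfolding hcoef_Suc[of "Suc m" a, symmetric] hcoef_Suc_Suc[symmetric] by (simp only: mult_ac)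
  have "of_nat (Suc m) * hcoef (a + 1) (Suc m) = of_nat (Suc m) * (hcoef a m - a * hcoef (a - 1) (Suc m))"
    unfolding 1 right_diff_distrib 2 by (simp add: algebra_simps)
  then show ?thesis using Suc by (simp del: of_nat_Suc)
qed

section \<open>Three-term recurrence and derivative of D in the complex plane\<close>

lemma parabolic_cylinder_D_recurrence:
  "parabolic_cylinder_D (a + 1) z = z * parabolic_cylinder_D a z - a * parabolic_cylinder_D (a - 1) z"
proof -
  let ?e = "exp (z ^ 2 / 4)"
  have "(\<lambda>n. hcoef a n * z ^ n * z) sums (?e * parabolic_cylinder_D a z * z)"
    by (intro sums_mult2 hcoef_sums)
  then have "(\<lambda>n. (if n = 0 then 0 else hcoef a (n - 1)) * z ^ n) sums (?e * parabolic_cylinder_D a z * z)"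
    by (subst sums_Suc_iff[symmetric, where ?f = "\<lambda>n. (if n = 0 then 0 else hcoef a (n - 1)) * z ^ n", simplified])
       (simp add: mult_ac)
  from sums_diff[OF this sums_mult[OF hcoef_sums[of "a - 1" z], of a]]
  have "(\<lambda>n. hcoef (a + 1) n * z ^ n) sums (?e * parabolic_cylinder_D a z * z - a * (?e * parabolic_cylinder_D (a - 1) z))"
    by (subst hcoef_plus1) (simp add: algebra_simps)
  from sums_unique2[OF this hcoef_sums]
  have "?e * parabolic_cylinder_D (a + 1) z = ?e * (z * parabolic_cylinder_D a z - a * parabolic_cylinder_D (a - 1) z)"
    by (simp add: algebra_simps)
  then show ?thesis by simp
qed

lemma has_field_derivative_parabolic_cylinder_D_lower:
  "(parabolic_cylinder_D a has_field_derivative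
      (- z / 2 * parabolic_cylinder_D a z + a * parabolic_cylinder_D (a - 1) z)) (at z)"
proof -
  have eq: "(\<lambda>n. \<Sum>k. hcoef b k * n ^ k) = (\<lambda>z. exp (z ^ 2 / 4) * parabolic_cylinder_D b z)" for b
    using hcoef_sums by (auto simp: sums_iff)
  have "((\<lambda>z. \<Sum>n. hcoef a n * z ^ n) has_field_derivative (\<Sum>n. diffs (hcoef a) n * z ^ n)) (at z)"
    by (rule termdiffs_strong_converges_everywhere) (use hcoef_sums in \<open>auto simp: sums_iff\<close>)
  also have "(\<Sum>n. diffs (hcoef a) n * z ^ n) = (\<Sum>n. a * (hcoef (a - 1) n * z ^ n))"
    by (simp only: diffs_def hcoef_Suc mult.assoc)
  also have "\<dots> = a * (exp (z ^ 2 / 4) * parabolic_cylinder_D (a - 1) z)"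
    using sums_mult[OF hcoef_sums[of "a - 1" z], of a] by (simp add: sums_iff)
  finally have *: "((\<lambda>z. exp (z ^ 2 / 4) * parabolic_cylinder_D a z) has_field_derivative
      a * (exp (z ^ 2 / 4) * parabolic_cylinder_D (a - 1) z)) (at z)"
    unfolding eq .
  have "((\<lambda>z. exp (- (z ^ 2) / 4) * (exp (z ^ 2 / 4) * parabolic_cylinder_D a z)) has_field_derivative
      exp (- (z ^ 2) / 4) * (a * (exp (z ^ 2 / 4) * parabolic_cylinder_D (a - 1) z))
       + (exp (- (z ^ 2) / 4) * (- z / 2)) * (exp (z ^ 2 / 4) * parabolic_cylinder_D a z)) (at z)"
    by (rule DERIV_mult' *)+ (auto intro!: derivative_eq_intros *)
  moreover have "exp (- (z ^ 2) / 4) * exp (z ^ 2 / 4) = 1" for z :: complex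
    by (simp flip: exp_add)
  then have c: "exp (- (z ^ 2) / 4) * (exp (z ^ 2 / 4) * w) = w" for w z :: complex
    by (metis mult.assoc mult_1)
  ultimately show ?thesis
    by (simp only: c mult.left_commute[of "exp (- (z ^ 2) / 4)" a] mult.assoc mult.left_commute[of _ "- z / 2"])
       (simp add: c mult.left_commute[of _ "z / 2"] add_ac)
qed

lemma parabolic_cylinder_D_at_0:
  "parabolic_cylinder_D a 0 = 2 powr (a/2) * of_real (sqrt pi) * rGamma (1/2 - a/2)"
  by (simp add: parabolic_cylinder_D_def kummer_Phi_def powser_zero[of "\<lambda>n. pochhammer (-a/2) n / pochhammer (1/2) n / fact n", simplified])

section \<open>Boundedness on the half line\<close>

definition pcD :: "complex \<Rightarrow> real \<Rightarrow> complex" where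
  "pcD a x = parabolic_cylinder_D a (of_real x)"

text \<open>The raising form of the derivative has no factor \<open>a\<close>: bounds for it need
  only the suprema at orders \<open>a\<close> and \<open>a + 1\<close>, and at 0 it reduces to -
  D_(a+1)(0).\<close>

definition pcD' :: "complex \<Rightarrow> real \<Rightarrow> complex" where
  "pcD' a x = of_real x / 2 * pcD a x - pcD (a + 1) x"

lemma pcD_recurrence: "pcD (a + 1) x = of_real x * pcD a x - a * pcD (a - 1) x"
  by (simp add: pcD_def parabolic_cylinder_D_recurrence)

lemma pcD'_alt: "pcD' a x = - of_real x / 2 * pcD a x + a * pcD (a - 1) x"
  by (simp add: pcD'_def pcD_recurrence)

lemma has_vector_derivative_pcD:
  "(pcD a has_vector_derivative pcD' a x) (at x within S)"
  using has_vector_derivative_real_field[OF has_field_derivative_parabolic_cylinder_D_lower[of a "of_real x"], of S]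
  by (simp add: pcD'_alt pcD_def[abs_def])

text \<open>Weber's equation. The raising form at order a and the lowering form at order a + 1 are
  combined so that the terms in D_(a+1) cancel.\<close>

lemma has_vector_derivative_pcD':
  "(pcD' a has_vector_derivative of_real (x ^ 2 / 4) * pcD a x - (a + 1/2) * pcD a x) (at x within S)"
proof -
  have "((\<lambda>x. of_real x / 2 * pcD a x - pcD (a + 1) x) has_vector_derivative
          (1 / 2 * pcD a x + of_real x / 2 * pcD' a x - pcD' (a + 1) x)) (at x within S)"
    by (auto intro!: derivative_eq_intros has_vector_derivative_pcD simp: has_vector_derivative_of_real)
  also have "1 / 2 * pcD a x + of_real x / 2 * pcD' a x - pcD' (a + 1) x
        = of_real (x ^ 2 / 4) * pcD a x - (a + 1/2) * pcD a x"
    unfolding pcD'_alt[of "a + 1"] pcD'_def[of a] by (simp add: algebra_simps power2_eq_square)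
  finally show ?thesis by (simp add: pcD'_def[abs_def])
qed

lemma pcD_0: "pcD a 0 = 2 powr (a/2) * of_real (sqrt pi) * rGamma (1/2 - a/2)"
  by (simp add: pcD_def parabolic_cylinder_D_at_0)

lemma pcD'_0: "pcD' a 0 = - pcD (a + 1) 0"
  by (simp add: pcD'_def)

lemma continuous_on_pcD: "continuous_on S (pcD a)"
  using has_vector_derivative_pcD
  by (meson continuous_on_eq_continuous_within has_vector_derivative_continuous)

text \<open>The duplication (2k)! = 4^k (1/2)_k k! merges the two parities into one formula. Its
  Gamma value is a moment of exp(-t), which turns the whole power series into an integral of
  t^(\<nu>/2 - 1) exp(-t - x sqrt(2 t)).\<close>

lemma hcoef_uminus:
  assumes "Re \<nu> > 0"
  shows "hcoef (- \<nu>) n = 2 powr (- \<nu> / 2) * of_real (sqrt pi) * rGamma (\<nu>/2) * rGamma (1/2 + \<nu>/2)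
           * ((- of_real (sqrt 2)) ^ n * Gamma ((\<nu> + of_nat n) / 2) / fact n)"
proof -
  have g: "pochhammer z k = Gamma (z + of_nat k) * rGamma z" if "Re z > 0" for z :: complex and k
  proof -
    have "z \<notin> \<int>\<^sub>\<le>\<^sub>0" using that by (rule Re_pos_not_nonpos_Int)
    then show ?thesis by (simp add: pochhammer_Gamma Gamma_def divide_inverse)
  qed
  have f: "fact (2 * k) = 2 ^ k * (pochhammer (1/2) k * 2 ^ k * fact k :: complex)" for k
    unfolding fact_double by (simp add: power_mult power2_eq_square flip: power_mult_distrib)
  have p: "pochhammer (3/2) k = pochhammer (1/2::complex) k * (2 * of_nat k + 1)" for k
    using pochhammer_rec[of "1/2::complex" k] pochhammer_rec'[of "1/2::complex" k]
    by (simp add: algebra_simps)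
  have s: "(- of_real (sqrt 2)) ^ (2 * k) = (2 ^ k :: complex)" for k
    by (simp add: power_mult flip: of_real_power)
  have nz: "fact (2 * k) \<noteq> (0::complex)" for k by simp
  show ?thesis
  proof (cases "even n")
    case True
    then obtain k where n: "n = 2 * k" by auto
    have e: "(\<nu> + of_nat (2 * k)) / 2 = \<nu> / 2 + of_nat k" by (simp add: add_divide_distrib)
    have "pochhammer (1/2) k * 2 ^ k * fact k = (fact (2 * k) / 2 ^ k :: complex)"
      unfolding f by simp
    then show ?thesis
      unfolding n hcoef_even s e using g[of "\<nu>/2" k] assms by (simp add: mult_ac)
  next
    case False
    then obtain k where n: "n = Suc (2 * k)" by (auto elim: oddE)
    have e: "(\<nu> + of_nat (Suc (2 * k))) / 2 = 1/2 + \<nu> / 2 + of_nat k" by (simp add: add_divide_distrib)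
    have "fact (Suc (2 * k)) / 2 ^ k = ((2 * of_nat k + 1) * fact (2 * k) / 2 ^ k :: complex)"
      by simp
    also have "\<dots> = pochhammer (3/2) k * 2 ^ k * fact k"
      unfolding f p by simp
    finally have F: "pochhammer (3/2) k * 2 ^ k * fact k = (fact (Suc (2 * k)) / 2 ^ k :: complex)" ..
    show ?thesis
      unfolding n hcoef_odd F power_Suc s e using g[of "1/2 + \<nu>/2" k] assms
      by (simp add: real_sqrt_mult mult_ac del: fact_Suc)
  qed
qed

text \<open>In the integral representation the factor exp(-x sqrt(2 t)) is at most 1 for x \<ge> 0,
  which leaves a convergent Gamma integral independent of x. Sum and integral are interchanged for
  each fixed x by dominated convergence.\<close>

lemma pcD_exp_bounded_negative:
  assumes nu: "Re \<nu> > 0"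
  shows "\<exists>C. \<forall>x\<ge>0. norm (exp (of_real (x ^ 2 / 4)) * pcD (- \<nu>) x) \<le> C"
proof -
  define K where "K = 2 powr (- \<nu> / 2) * of_real (sqrt pi) * rGamma (\<nu>/2) * rGamma (1/2 + \<nu>/2)"
  define w where "w = (\<lambda>t::real. of_real t powr (\<nu>/2 - 1) / of_real (exp t) :: complex)"
  have w_abs: "w absolutely_integrable_on {0<..}"
    unfolding w_def using absolutely_integrable_Gamma_integral'[of "\<nu>/2"] nu by simp
  have "norm (exp (of_real (x ^ 2 / 4)) * pcD (- \<nu>) x) \<le> norm K * integral {0<..} (\<lambda>t. norm (w t))"
    if x: "x \<ge> 0" for x
  proof -
    define f where "f = (\<lambda>N t. K * (w t * (\<Sum>n<N. of_real ((- (x * sqrt (2 * t))) ^ n / fact n))))"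
    define g where "g = (\<lambda>t. K * (w t * of_real (exp (- (x * sqrt (2 * t))))))"
    \<comment> \<open>The partial sums of exp(-u), with u = x sqrt(2 t), are only bounded by exp(u).
      From (sqrt(t/2) - x)^2 \<ge> 0 follows u \<le> t/2 + x^2, so that exp(-t/2) remains for
      integrability.\<close>
    define h where "h = (\<lambda>t. norm K * exp (x ^ 2) * norm (of_real t powr (\<nu>/2 - 1) / of_real (exp (1/2 * t)) :: complex))"
    have summand: "((\<lambda>t. K * (w t * of_real ((- (x * sqrt (2 * t))) ^ n / fact n)))
        has_integral hcoef (- \<nu>) n * of_real x ^ n) {0<..}" for n
    proof -
      have "Re ((\<nu> + of_nat n) / 2) > 0" using nu by simp
      note Gamma_integral_complex'[OF this]
      then have *: "((\<lambda>t. K * (of_real ((- (x * sqrt 2)) ^ n / fact n) * (of_real t powr ((\<nu> + of_nat n) / 2 - 1) / of_real (exp t))))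
          has_integral K * (of_real ((- (x * sqrt 2)) ^ n / fact n) * Gamma ((\<nu> + of_nat n) / 2))) {0<..}"
        by (intro has_integral_mult_right)
      have "complex_of_real ((- (x * sqrt 2)) ^ n) = (- of_real (sqrt 2) * of_real x) ^ n"
        by (simp add: mult.commute)
      then have c: "complex_of_real ((- (x * sqrt 2)) ^ n / fact n) = (- of_real (sqrt 2)) ^ n * of_real x ^ n / fact n"
        unfolding power_mult_distrib[of "- of_real (sqrt 2)"] by simp
      have "K * (of_real ((- (x * sqrt 2)) ^ n / fact n) * Gamma ((\<nu> + of_nat n) / 2)) = hcoef (- \<nu>) n * of_real x ^ n"
        unfolding hcoef_uminus[OF nu] K_def[symmetric] c by (simp only: mult_ac times_divide_eq_left times_divide_eq_right)
      moreover have "K * (of_real ((- (x * sqrt 2)) ^ n / fact n) * (of_real t powr ((\<nu> + of_nat n) / 2 - 1) / of_real (exp t)))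
         = K * (w t * of_real ((- (x * sqrt (2 * t))) ^ n / fact n))" if "t > 0" for t
      proof -
        have "complex_of_real t powr ((\<nu> + of_nat n) / 2 - 1) = of_real t powr (\<nu>/2 - 1) * of_real t powr (of_nat n / 2)"
          by (simp add: powr_add[symmetric] add_divide_distrib algebra_simps)
        also have "complex_of_real t powr (of_nat n / 2) = of_real (t powr (real n / 2))"
          using that by (simp add: powr_of_real[symmetric])
        also have "t powr (real n / 2) = sqrt t ^ n"
          using that by (simp add: powr_half_sqrt[symmetric] powr_powr flip: powr_realpow)
        finally show ?thesis
          by (simp add: w_def real_sqrt_mult power_mult_distrib power_minus[of "x * _"] mult_ac)
      qed
      ultimately show ?thesis using has_integral_eq[OF _ *] by simp
    qed
    have sumsx: "(\<lambda>n. hcoef (- \<nu>) n * of_real x ^ n) sums (exp (of_real (x ^ 2 / 4)) * pcD (- \<nu>) x)"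
      using hcoef_sums[of "- \<nu>" "of_real x"] by (simp add: pcD_def)
    have I: "(g has_integral (exp (of_real (x ^ 2 / 4)) * pcD (- \<nu>) x)) {0<..}"
    proof (rule has_integral_dominated_convergence)
      show "(f N has_integral (\<Sum>n<N. hcoef (- \<nu>) n * of_real x ^ n)) {0<..}" for N
      proof -
        have "((\<lambda>t. \<Sum>n<N. K * (w t * of_real ((- (x * sqrt (2 * t))) ^ n / fact n))) has_integral
            (\<Sum>n<N. hcoef (- \<nu>) n * of_real x ^ n)) {0<..}"
          by (intro has_integral_sum summand) auto
        then show ?thesis by (simp add: f_def sum_distrib_left)
      qed
      show "h integrable_on {0<..}"
        unfolding h_def using absolutely_integrable_Gamma_integral[of "\<nu>/2" "1/2"] nu
        by (intro integrable_on_mult_right) (auto simp: absolutely_integrable_on_def)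
      show "\<forall>t\<in>{0<..}. norm (f N t) \<le> h t" for N
      proof
        fix t :: real assume t: "t \<in> {0<..}"
        let ?u = "x * sqrt (2 * t)"
        have "norm (\<Sum>n<N. complex_of_real ((- ?u) ^ n / fact n)) \<le> (\<Sum>n<N. norm (complex_of_real ((- ?u) ^ n / fact n)))"
          by (rule norm_sum)
        also have "\<dots> = (\<Sum>n<N. ?u ^ n / fact n)"
          using x t by (intro sum.cong refl) (simp add: norm_divide norm_mult norm_power power_abs abs_mult)
        also have "\<dots> \<le> exp ?u"
          using x t exp_converges[of ?u] by (intro sum_le_suminf[THEN order_trans]) (auto simp: sums_iff divide_inverse mult_ac)
        also have "exp ?u \<le> exp (t / 2 + x ^ 2)"
        proof -
          have "0 \<le> (sqrt (t/2) - x) ^ 2" by simp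
          also have "\<dots> = t / 2 + x ^ 2 - x * (2 * sqrt (t / 2))"
            using t by (simp add: power2_diff)
          also have "2 * sqrt (t / 2) = sqrt (2 * t)"
            by (rule real_sqrt_unique[symmetric]) (use t in \<open>auto simp: power_mult_distrib\<close>)
          finally show ?thesis by simp
        qed
        finally have *: "norm (\<Sum>n<N. complex_of_real ((- ?u) ^ n / fact n)) \<le> exp (t / 2 + x ^ 2)" .
        have "norm (f N t) = norm K * norm (w t) * norm (\<Sum>n<N. complex_of_real ((- ?u) ^ n / fact n))"
          by (simp add: f_def norm_mult)
        also have "\<dots> \<le> norm K * norm (w t) * exp (t / 2 + x ^ 2)"
          by (intro mult_left_mono *) auto
        also have "\<dots> = h t"
        proof -
          have "exp t = exp (t/2) * exp (t/2)" by (simp flip: exp_add)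
          then show ?thesis by (simp add: h_def w_def norm_divide norm_mult exp_add)
        qed
        finally show "norm (f N t) \<le> h t" .
      qed
      show "\<forall>t\<in>{0<..}. (\<lambda>N. f N t) \<longlonglongrightarrow> g t"
      proof
        fix t :: real
        have "(\<lambda>n. (- (x * sqrt (2 * t))) ^ n / fact n) sums exp (- (x * sqrt (2 * t)))"
          using exp_converges[of "- (x * sqrt (2 * t))"] by (simp add: divide_inverse mult_ac)
        then have "(\<lambda>N. \<Sum>n<N. complex_of_real ((- (x * sqrt (2 * t))) ^ n / fact n)) \<longlonglongrightarrow> of_real (exp (- (x * sqrt (2 * t))))"
          unfolding sums_def of_real_sum[symmetric] by (rule tendsto_of_real)
        then show "(\<lambda>N. f N t) \<longlonglongrightarrow> g t"
          unfolding f_def g_def by (intro tendsto_intros)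
      qed
      show "(\<lambda>N. \<Sum>n<N. hcoef (- \<nu>) n * of_real x ^ n) \<longlonglongrightarrow> exp (of_real (x ^ 2 / 4)) * pcD (- \<nu>) x"
        using sumsx by (simp add: sums_def)
    qed
    have wi: "(\<lambda>t. norm K * norm (w t)) integrable_on {0<..}"
      using w_abs by (intro integrable_on_mult_right) (auto simp: absolutely_integrable_on_def)
    have "norm (integral {0<..} g) \<le> integral {0<..} (\<lambda>t. norm K * norm (w t))"
    proof (rule integral_norm_bound_integral)
      show "g integrable_on {0<..}" using I by blast
      fix t :: real assume "t \<in> {0<..}"
      then have "exp (- (x * sqrt (2 * t))) \<le> 1" using x by simp
      then have "norm K * norm (w t) * exp (- (x * sqrt (2 * t))) \<le> norm K * norm (w t) * 1"
        by (intro mult_left_mono) auto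
      then show "norm (g t) \<le> norm K * norm (w t)" by (simp add: g_def norm_mult)
    qed (fact wi)
    moreover have "integral {0<..} g = exp (of_real (x ^ 2 / 4)) * pcD (- \<nu>) x"
      using I by (rule integral_unique)
    ultimately show ?thesis by simp
  qed
  then show ?thesis by blast
qed

text \<open>Each step up in the order costs a factor 1 + x by the recurrence. The constants are not
  controlled in the order; only the boundedness of each single D_a is drawn from here, and the
  dependence on the order comes from the energy.\<close>

lemma pcD_exp_bounded:
  "\<exists>C k. \<forall>x\<ge>0. norm (exp (of_real (x ^ 2 / 4)) * pcD a x) \<le> C * (1 + x) ^ k"
proof -
  have "\<forall>a. Re a < real m \<longrightarrow> (\<exists>C k. \<forall>x\<ge>0. norm (exp (of_real (x ^ 2 / 4)) * pcD a x) \<le> C * (1 + x) ^ k)" for m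
  proof (induction m)
    case 0
    show ?case
    proof (intro allI impI)
      fix a :: complex assume "Re a < real 0"
      then obtain C where "\<forall>x\<ge>0. norm (exp (of_real (x ^ 2 / 4)) * pcD a x) \<le> C"
        using pcD_exp_bounded_negative[of "- a"] by auto
      then show "\<exists>C k. \<forall>x\<ge>0. norm (exp (of_real (x ^ 2 / 4)) * pcD a x) \<le> C * (1 + x) ^ k"
        by (intro exI[of _ C] exI[of _ 0]) simp
    qed
  next
    case (Suc m)
    show ?case
    proof (intro allI impI)
      fix a :: complex assume "Re a < real (Suc m)"
      then have "Re (a - 1) < real m" "Re (a - 2) < real m" by auto
      note IH = this[THEN Suc.IH[rule_format]]
      obtain C1 k1 where 1: "\<And>x. x \<ge> 0 \<Longrightarrow> norm (exp (of_real (x ^ 2 / 4)) * pcD (a - 1) x) \<le> C1 * (1 + x) ^ k1"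
        using IH(1) by blast
      obtain C2 k2 where 2: "\<And>x. x \<ge> 0 \<Longrightarrow> norm (exp (of_real (x ^ 2 / 4)) * pcD (a - 2) x) \<le> C2 * (1 + x) ^ k2"
        using IH(2) by blast
      have "norm (exp (of_real (x ^ 2 / 4)) * pcD a x) \<le> (C1 + norm (a - 1) * C2) * (1 + x) ^ (k1 + k2 + 1)"
        if x: "x \<ge> 0" for x
      proof -
        let ?e = "exp (of_real (x ^ 2 / 4)) :: complex"
        have C: "C1 \<ge> 0" "C2 \<ge> 0"
          using norm_ge_zero[THEN order_trans, OF 1[of 0]] norm_ge_zero[THEN order_trans, OF 2[of 0]] by auto
        have r: "pcD a x = of_real x * pcD (a - 1) x - (a - 1) * pcD (a - 2) x"
          using pcD_recurrence[of "a - 1" x] by simp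
        have "?e * pcD a x = of_real x * (?e * pcD (a - 1) x) - (a - 1) * (?e * pcD (a - 2) x)"
          unfolding r by (simp only: right_diff_distrib mult_ac)
        then have "norm (?e * pcD a x) \<le> norm (of_real x * (?e * pcD (a - 1) x)) + norm ((a - 1) * (?e * pcD (a - 2) x))"
          by (metis norm_triangle_ineq4)
        also have "\<dots> = x * norm (?e * pcD (a - 1) x) + norm (a - 1) * norm (?e * pcD (a - 2) x)"
          using x by (simp add: norm_mult)
        also have "\<dots> \<le> (1 + x) * (C1 * (1 + x) ^ k1) + norm (a - 1) * (C2 * (1 + x) ^ k2)"
          using x by (intro add_mono mult_mono 1 2) auto
        also have "\<dots> \<le> C1 * (1 + x) ^ (k1 + k2 + 1) + norm (a - 1) * (C2 * (1 + x) ^ (k1 + k2 + 1))"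
        proof -
          have "(1 + x) ^ (k1 + 1) \<le> (1 + x) ^ (k1 + k2 + 1)" "(1 + x) ^ k2 \<le> (1 + x) ^ (k1 + k2 + 1)"
            using x by (intro power_increasing; simp)+
          then have "C1 * (1 + x) ^ (k1 + 1) \<le> C1 * (1 + x) ^ (k1 + k2 + 1)"
            "norm (a - 1) * (C2 * (1 + x) ^ k2) \<le> norm (a - 1) * (C2 * (1 + x) ^ (k1 + k2 + 1))"
            using C by (auto intro!: mult_left_mono)
          then show ?thesis by (simp add: mult_ac)
        qed
        also have "\<dots> = (C1 + norm (a - 1) * C2) * (1 + x) ^ (k1 + k2 + 1)"
          by (simp add: algebra_simps)
        finally show ?thesis .
      qed
      then show "\<exists>C k. \<forall>x\<ge>0. norm (exp (of_real (x ^ 2 / 4)) * pcD a x) \<le> C * (1 + x) ^ k" by blast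
    qed
  qed
  moreover obtain m where "Re a < real m" using reals_Archimedean2 by blast
  ultimately show ?thesis by blast
qed

lemma pcD_bounded: "bdd_above ((\<lambda>x. norm (pcD a x)) ` {0..})"
proof -
  obtain C k where C: "\<And>x. x \<ge> 0 \<Longrightarrow> norm (exp (of_real (x ^ 2 / 4)) * pcD a x) \<le> C * (1 + x) ^ k"
    using pcD_exp_bounded by blast
  have "(\<lambda>x. C * (1 + x) ^ k * exp (- (x ^ 2) / 4)) \<in> O[at_top](\<lambda>_. 1)" 
    by real_asymp
  then obtain M where "\<forall>\<^sub>F x in at_top. norm (C * (1 + x) ^ k * exp (- (x ^ 2) / 4)) \<le> M"
    by (auto elim!: landau_o.bigE)
  then obtain X where X: "\<And>x. x \<ge> X \<Longrightarrow> norm (C * (1 + x) ^ k * exp (- (x ^ 2) / 4)) \<le> M"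
    by (auto simp: eventually_at_top_linorder)
  have "compact ((\<lambda>x. norm (pcD a x)) ` {0..max 0 X})"
    by (intro compact_continuous_image continuous_intros continuous_on_pcD) auto
  then obtain M' where M': "\<And>x. x \<in> {0..max 0 X} \<Longrightarrow> norm (pcD a x) \<le> M'"
    using bounded_imp_bdd_above[OF compact_imp_bounded] by (meson bdd_above.unfold imageI)
  show ?thesis
  proof (rule bdd_aboveI2[of _ _ "max M M'"])
    fix x :: real assume x: "x \<in> {0..}"
    show "norm (pcD a x) \<le> max M M'"
    proof (cases "x \<le> X")
      case True
      then show ?thesis using M'[of x] x by simp
    next
      case False
      have "norm (pcD a x) = norm (exp (of_real (x ^ 2 / 4)) * pcD a x) * exp (- (x ^ 2) / 4)"
        by (simp add: norm_mult exp_minus)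
      also have "\<dots> \<le> C * (1 + x) ^ k * exp (- (x ^ 2) / 4)"
        using C[of x] x by (intro mult_right_mono) auto
      also have "\<dots> \<le> M" using X[of x] False by simp
      finally show ?thesis by simp
    qed
  qed
qed

section \<open>The energy estimate\<close>

text \<open>A positive slope anywhere would force at least linear growth by convexity, against the
  upper bound.\<close>

lemma convex_bounded_imp_nonincreasing:
  fixes v v' v'' :: "real \<Rightarrow> real"
  assumes v: "\<And>x. x > c \<Longrightarrow> (v has_real_derivative v' x) (at x)"
    and v': "\<And>x. x > c \<Longrightarrow> (v' has_real_derivative v'' x) (at x)"
    and pos: "\<And>x. x > c \<Longrightarrow> v'' x \<ge> 0"
    and cont: "continuous_on {c..} v"
    and bdd: "\<And>x. x > c \<Longrightarrow> v x \<le> B"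
    and xy: "c \<le> x" "x \<le> y"
  shows "v y \<le> v x"
proof -
  have mono: "v' s \<le> v' t" if "c < s" "s \<le> t" for s t
    by (rule DERIV_nonneg_imp_nondecreasing[OF \<open>s \<le> t\<close>]) (use that v' pos in \<open>meson order.strict_trans2\<close>)
  have neg: "v' s \<le> 0" if s: "s > c" for s
  proof (rule ccontr)
    assume "\<not> v' s \<le> 0"
    then have p: "v' s > 0" by simp
    have grow: "v s + v' s * (t - s) \<le> v t" if "t \<ge> s" for t
    proof -
      have "v s - v' s * s \<le> v t - v' s * t"
      proof (rule DERIV_nonneg_imp_nondecreasing[OF that])
        fix r assume "s \<le> r" "r \<le> t"
        then have "((\<lambda>r. v r - v' s * r) has_real_derivative v' r - v' s * 1) (at r)"
          using s by (intro DERIV_diff v DERIV_cmult DERIV_ident) auto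
        moreover have "v' r - v' s * 1 \<ge> 0" using mono[OF s \<open>s \<le> r\<close>] by simp
        ultimately show "\<exists>y. ((\<lambda>r. v r - v' s * r) has_real_derivative y) (at r) \<and> 0 \<le> y" by blast
      qed
      then show ?thesis by (simp add: algebra_simps)
    qed
    \<comment> \<open>The point where the tangent at s has risen by |B - v s| + 1 and therefore lies
      above B.\<close>
    define t where "t = s + (\<bar>B - v s\<bar> + 1) / v' s"
    have "t \<ge> s" using p by (simp add: t_def)
    then have "v s + v' s * (t - s) \<le> B" using grow[of t] bdd[of t] s by simp
    moreover have "v' s * (t - s) = \<bar>B - v s\<bar> + 1" using p by (simp add: t_def)
    ultimately show False by linarith
  qed
  show ?thesis
  proof (rule DERIV_nonpos_imp_decreasing_open[OF xy(2)])
    show "continuous_on {x..y} v" using cont xy by (auto intro: continuous_on_subset)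
  qed (use v neg xy in force)
qed

lemma inner_complex_mult_same: "u \<bullet> (q * u) = Re q * norm u ^ 2" for u q :: complex
  unfolding inner_complex_def cmod_power2 by (simp add: algebra_simps power2_eq_square)

text \<open>The second derivative of |u|^2 is 2 (Re q |u|^2 + |u'|^2). The lemma serves twice: for D
  beyond its turning point, and for differences of solutions that start from 0 and hence
  vanish.\<close>

lemma bounded_ode_norm_nonincreasing:
  fixes u u' q :: "real \<Rightarrow> complex"
  assumes u: "\<And>x. x > c \<Longrightarrow> (u has_vector_derivative u' x) (at x)"
    and u': "\<And>x. x > c \<Longrightarrow> (u' has_vector_derivative q x * u x) (at x)"
    and q: "\<And>x. x > c \<Longrightarrow> Re (q x) \<ge> 0"
    and cont: "continuous_on {c..} u"
    and bdd: "\<And>x. x > c \<Longrightarrow> norm (u x) \<le> B"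
    and xy: "c \<le> x" "x \<le> y"
  shows "norm (u y) \<le> norm (u x)"
proof -
  have "u y \<bullet> u y \<le> u x \<bullet> u x"
  proof (rule convex_bounded_imp_nonincreasing[OF _ _ _ _ _ xy])
    fix x assume x: "x > c"
    show "((\<lambda>x. u x \<bullet> u x) has_real_derivative 2 * (u x \<bullet> u' x)) (at x)"
      using bounded_bilinear.has_vector_derivative[OF bounded_bilinear_inner u u, OF x x]
      by (simp add: has_real_derivative_iff_has_vector_derivative inner_commute)
    have "((\<lambda>x. u x \<bullet> u' x) has_real_derivative (u x \<bullet> (q x * u x) + u' x \<bullet> u' x)) (at x)"
      using bounded_bilinear.has_vector_derivative[OF bounded_bilinear_inner u u', OF x x]
      by (simp add: has_real_derivative_iff_has_vector_derivative)
    then show "((\<lambda>x. 2 * (u x \<bullet> u' x)) has_real_derivative 2 * (u x \<bullet> (q x * u x) + u' x \<bullet> u' x)) (at x)"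
      by (rule DERIV_cmult)
    show "0 \<le> 2 * (u x \<bullet> (q x * u x) + u' x \<bullet> u' x)"
      unfolding inner_complex_mult_same using q[OF x] by simp
    have "norm (u x) * norm (u x) \<le> B * B"
      using bdd[OF x] order_trans[OF norm_ge_zero bdd[OF x]] by (intro mult_mono) auto
    then show "u x \<bullet> u x \<le> B * B" by (simp add: dot_square_norm power2_eq_square)
  next
    show "continuous_on {c..} (\<lambda>x. u x \<bullet> u x)" by (intro continuous_intros cont)
  qed
  then show ?thesis by (simp add: norm_le)
qed

text \<open>The energy |D'|^2 + (b + 1/2 - x^2/4) |D|^2 of D_b at x = 0, with D_b'(0) = - D_(b+1)(0)
  inserted.\<close>

definition pcD_energy :: "real \<Rightarrow> real" where
  "pcD_energy b = norm (pcD (of_real b + 1) 0) ^ 2 + (b + 1/2) * norm (pcD (of_real b) 0) ^ 2"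

text \<open>By Weber's equation the products of D and D' cancel, and the derivative of the energy is
  -x/2 |D|^2, which stems from the explicit x^2 alone.\<close>

lemma pcD_energy_bound:
  assumes "x \<ge> 0"
  shows "norm (pcD' (of_real b) x) ^ 2 + (b + 1/2 - x ^ 2 / 4) * norm (pcD (of_real b) x) ^ 2 \<le> pcD_energy b"
proof -
  let ?u = "pcD (of_real b)" and ?v = "pcD' (of_real b)"
  define E where "E = (\<lambda>x. ?v x \<bullet> ?v x + (b + 1/2 - x ^ 2 / 4) * (?u x \<bullet> ?u x))"
  have "E x \<le> E 0"
  proof (rule DERIV_nonpos_imp_nonincreasing[OF assms])
    fix t :: real assume t: "0 \<le> t"
    let ?q = "of_real (t ^ 2 / 4 - (b + 1/2)) :: complex"
    have u: "(?u has_vector_derivative ?v t) (at t)" by (rule has_vector_derivative_pcD)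
    have 1: "((\<lambda>x. ?u x \<bullet> ?u x) has_real_derivative 2 * (?u t \<bullet> ?v t)) (at t)"
      using bounded_bilinear.has_vector_derivative[OF bounded_bilinear_inner u u]
      by (simp add: has_real_derivative_iff_has_vector_derivative inner_commute)
    have v: "(?v has_vector_derivative ?q * ?u t) (at t)"
      using has_vector_derivative_pcD'[of "of_real b" t UNIV] by (simp add: algebra_simps)
    have 2: "((\<lambda>x. ?v x \<bullet> ?v x) has_real_derivative 2 * (?v t \<bullet> (?q * ?u t))) (at t)"
      using bounded_bilinear.has_vector_derivative[OF bounded_bilinear_inner v v]
      by (simp add: has_real_derivative_iff_has_vector_derivative inner_commute)
    have qu: "?v t \<bullet> (?q * ?u t) = (t ^ 2 / 4 - (b + 1/2)) * (?u t \<bullet> ?v t)"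
      by (metis inner_commute inner_scaleR_right scaleR_conv_of_real)
    have "(E has_real_derivative (2 * (?v t \<bullet> (?q * ?u t)) + ((b + 1/2 - t ^ 2 / 4) * (2 * (?u t \<bullet> ?v t)) + (- t / 2) * (?u t \<bullet> ?u t)))) (at t)"
      unfolding E_def by (rule DERIV_add[OF 2] DERIV_mult'[OF _ 1])+ (auto intro!: derivative_eq_intros)
    moreover have "2 * (?v t \<bullet> (?q * ?u t)) + ((b + 1/2 - t ^ 2 / 4) * (2 * (?u t \<bullet> ?v t)) + (- t / 2) * (?u t \<bullet> ?u t))
        = - t / 2 * (?u t \<bullet> ?u t)"
      unfolding qu by (simp add: algebra_simps)
    moreover have "- t / 2 * (?u t \<bullet> ?u t) \<le> 0" using t by (simp add: mult_nonneg_nonneg)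
    ultimately show "\<exists>y. (E has_real_derivative y) (at t) \<and> y \<le> 0" by metis
  qed
  moreover have "E 0 = pcD_energy b"
    by (simp add: E_def pcD_energy_def pcD'_0 dot_square_norm)
  ultimately show ?thesis by (simp add: E_def dot_square_norm)
qed

lemma pcD_energy_nonneg: "b \<ge> -1/2 \<Longrightarrow> pcD_energy b \<ge> 0"
  by (simp add: pcD_energy_def)

text \<open>For fixed x and growing b this gains a factor of order 1/b over the energy; the gain is
  lost as x approaches the turning point 2 sqrt(b + 1/2).\<close>

lemma pcD_le_energy_pointwise:
  assumes "x \<ge> 0" "b + 1/2 - x ^ 2 / 4 > 0"
  shows "norm (pcD (of_real b) x) ^ 2 \<le> pcD_energy b / (b + 1/2 - x ^ 2 / 4)"
proof -
  have "norm (pcD (of_real b) x) ^ 2 * (b + 1/2 - x ^ 2 / 4) \<le> pcD_energy b"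
    using pcD_energy_bound[OF assms(1), of b] by (smt (verit) mult.commute zero_le_power2)
  then show ?thesis using assms(2) by (simp add: pos_le_divide_eq)
qed

text \<open>Up to the turning point \<open>Y\<close> the energy bounds |D'|, so D departs from its
  value at 0 by at most \<open>Y\<close> times that bound. Beyond \<open>Y\<close> the coefficient
  in Weber's equation is nonnegative and the bounded solution decreases in modulus. The 3 is 1 for
  the value at 0 plus 2 from \<open>Y = 2 * sqrt a\<close>.\<close>

lemma pcD_le_energy_uniform:
  assumes "x \<ge> 0" "b \<ge> 1/2"
  shows "norm (pcD (of_real b) x) \<le> 3 * sqrt (b + 1/2) * sqrt (pcD_energy b)"
proof -
  define a where "a = b + 1/2"
  define Y where "Y = 2 * sqrt a"
  have a: "a \<ge> 1" using assms by (simp add: a_def)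
  have Y2: "Y ^ 2 / 4 = a" using a by (simp add: Y_def power_mult_distrib)
  have Y0: "Y \<ge> 0" using a by (simp add: Y_def)
  have sq: "sqrt a \<ge> 1" using a by simp
  have E0: "pcD_energy b \<ge> 0" using assms by (intro pcD_energy_nonneg) auto
  have start: "norm (pcD (of_real b) 0) \<le> sqrt (pcD_energy b)"
  proof (rule real_le_rsqrt)
    have "norm (pcD (of_real b) 0) ^ 2 \<le> pcD_energy b / a"
      using pcD_le_energy_pointwise[of 0 b] a by (simp add: a_def)
    also have "\<dots> \<le> pcD_energy b" using a E0 by (simp add: divide_le_eq mult_le_cancel_left1)
    finally show "norm (pcD (of_real b) 0) ^ 2 \<le> pcD_energy b" .
  qed
  have inside: "norm (pcD (of_real b) x) \<le> 3 * sqrt a * sqrt (pcD_energy b)" if x: "0 \<le> x" "x \<le> Y" for x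
  proof -
    have "norm (pcD (of_real b) x - pcD (of_real b) 0) \<le> sqrt (pcD_energy b) * x - sqrt (pcD_energy b) * 0"
    proof (cases "x = 0")
      case False
      then have "0 < x" using x by simp
      then show ?thesis
      proof (rule differentiable_bound_general)
        show "continuous_on {0..x} (pcD (of_real b))" by (rule continuous_on_pcD)
        fix t assume t: "0 < t" "t < x"
        show "(pcD (of_real b) has_vector_derivative pcD' (of_real b) t) (at t)"
          by (rule has_vector_derivative_pcD)
        show "((*) (sqrt (pcD_energy b)) has_vector_derivative sqrt (pcD_energy b)) (at t)"
          by (auto intro!: derivative_eq_intros simp flip: has_real_derivative_iff_has_vector_derivative)
        have "t ^ 2 \<le> Y ^ 2" using t x by (intro power_mono) auto
        then have "t ^ 2 / 4 \<le> a" using Y2 by simp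
        then have "norm (pcD' (of_real b) t) ^ 2 \<le> pcD_energy b"
          using pcD_energy_bound[of t b] t
          by (smt (verit) a_def mult_nonneg_nonneg zero_le_power2)
        then show "norm (pcD' (of_real b) t) \<le> sqrt (pcD_energy b)" by (rule real_le_rsqrt)
      qed (intro continuous_intros)
    qed simp
    then have "norm (pcD (of_real b) x) \<le> sqrt (pcD_energy b) + sqrt (pcD_energy b) * x"
      using start norm_triangle_sub[of "pcD (of_real b) x" "pcD (of_real b) 0"] by simp
    also have "\<dots> \<le> sqrt (pcD_energy b) * sqrt a + sqrt (pcD_energy b) * (2 * sqrt a)"
      using sq x E0 by (intro add_mono mult_left_mono) (auto simp: Y_def mult_le_cancel_left1)
    also have "\<dots> = 3 * sqrt a * sqrt (pcD_energy b)" by simp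
    finally show ?thesis .
  qed
  show ?thesis
  proof (cases "x \<le> Y")
    case True
    then show ?thesis using inside assms by (simp add: a_def)
  next
    case False
    obtain B where B: "\<And>x. x \<ge> 0 \<Longrightarrow> norm (pcD (of_real b) x) \<le> B"
      using pcD_bounded[of "of_real b"] by (auto simp: bdd_above_def)
    have "norm (pcD (of_real b) x) \<le> norm (pcD (of_real b) Y)"
    proof (rule bounded_ode_norm_nonincreasing[where c = Y])
      fix t assume t: "t > Y"
      show "(pcD (of_real b) has_vector_derivative pcD' (of_real b) t) (at t)"
        by (rule has_vector_derivative_pcD)
      show "(pcD' (of_real b) has_vector_derivative of_real (t ^ 2 / 4 - a) * pcD (of_real b) t) (at t)"
        using has_vector_derivative_pcD'[of "of_real b" t UNIV] by (simp add: algebra_simps a_def)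
      show "0 \<le> Re (of_real (t ^ 2 / 4 - a))"
      proof -
        have "Y ^ 2 \<le> t ^ 2" using t Y0 by (intro power_mono) auto
        then show ?thesis using Y2 by simp
      qed
      show "norm (pcD (of_real b) t) \<le> B" using B t Y0 by simp
    qed (use False in \<open>auto intro: continuous_on_pcD\<close>)
    also have "\<dots> \<le> 3 * sqrt a * sqrt (pcD_energy b)" by (rule inside) (use Y0 in auto)
    finally show ?thesis by (simp add: a_def)
  qed
qed

definition pcD_sup :: "complex \<Rightarrow> real" where
  "pcD_sup a = (SUP x\<in>{0..}. norm (pcD a x))"

lemma pcD_le_sup: "x \<ge> 0 \<Longrightarrow> norm (pcD a x) \<le> pcD_sup a"
  unfolding pcD_sup_def by (rule cSUP_upper[OF _ pcD_bounded]) simp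

lemma pcD_sup_nonneg: "pcD_sup a \<ge> 0"
  using pcD_le_sup[of 0 a] norm_ge_zero order_trans by blast

lemma pcD_sup_le_energy:
  "b \<ge> 1/2 \<Longrightarrow> pcD_sup (of_real b) \<le> 3 * sqrt (b + 1/2) * sqrt (pcD_energy b)"
  unfolding pcD_sup_def by (rule cSUP_least) (auto intro: pcD_le_energy_uniform)

section \<open>Growth in the order\<close>

text \<open>Wendel's inequality: log-convexity between x and x + 1, combined with Gamma(x + 1) = x
  Gamma(x).\<close>

lemma Gamma_add_le:
  assumes "0 \<le> a" "a \<le> 1" "x > (0::real)"
  shows "Gamma (x + a) \<le> x powr a * Gamma x"
proof -
  have "ln (Gamma ((1 - a) * x + a * (x + 1))) \<le> (1 - a) * ln (Gamma x) + a * ln (Gamma (x + 1))"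
    using convex_onD[OF log_convex_Gamma_real assms(1,2), of x "x + 1"] assms(3) by simp
  also have "(1 - a) * x + a * (x + 1) = x + a" by (simp add: algebra_simps)
  also have "Gamma (x + 1) = x * Gamma x" using assms by (intro Gamma_plus1) auto
  also have "(1 - a) * ln (Gamma x) + a * ln (x * Gamma x) = ln (x powr a * Gamma x)"
    using assms by (simp add: ln_mult ln_powr Gamma_real_pos algebra_simps)
  finally show ?thesis
    using assms by (subst (asm) ln_le_cancel_iff) (auto simp: Gamma_real_pos)
qed

lemma bigo_transfer:
  assumes "f \<in> O[F](g)" "\<forall>\<^sub>F x in F. f x = f' x" "\<forall>\<^sub>F x in F. g x = g' x"
  shows "f' \<in> O[F](g')"
  using assms(1) landau_o.big.in_cong[OF assms(2)] landau_o.big.cong[OF assms(3)] by simp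

text \<open>Only the fractional part of the shift needs convexity; the functional equation supplies
  the integer part in both directions.\<close>

lemma Gamma_add_bigo: "(\<lambda>x::real. Gamma (x + a)) \<in> O[at_top](\<lambda>x. x powr a * Gamma x)"
proof -
  have frac: "(\<lambda>x::real. Gamma (x + r)) \<in> O[at_top](\<lambda>x. x powr r * Gamma x)" if "0 \<le> r" "r \<le> 1" for r
  proof (rule bigoI[of _ 1])
    show "\<forall>\<^sub>F x in at_top. norm (Gamma (x + r)) \<le> 1 * norm (x powr r * Gamma x)"
      using eventually_gt_at_top[of 0]
    proof eventually_elim
      case (elim x)
      then show ?case using Gamma_add_le[OF that, of x] that by (simp add: Gamma_real_pos abs_of_pos add_pos_nonneg)
    qed
  qed
  have up: "(\<lambda>x::real. Gamma (x + (s + 1))) \<in> O[at_top](\<lambda>x. x powr (s + 1) * Gamma x)"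
    if "(\<lambda>x::real. Gamma (x + s)) \<in> O[at_top](\<lambda>x. x powr s * Gamma x)" for s
  proof -
    have "(\<lambda>x. (x + s) * Gamma (x + s)) \<in> O[at_top](\<lambda>x. x * (x powr s * Gamma x))"
      by (intro landau_o.big.mult that) real_asymp
    moreover have "\<forall>\<^sub>F x in at_top. (x + s) * Gamma (x + s) = Gamma (x + (s + 1))"
      using eventually_gt_at_top[of "-s"]
    proof eventually_elim
      case (elim x)
      then have "x + s \<notin> \<int>\<^sub>\<le>\<^sub>0" by (auto elim!: nonpos_Ints_cases)
      then show ?case using Gamma_plus1[of "x + s"] by (simp add: add.assoc)
    qed
    moreover have "\<forall>\<^sub>F x in at_top. x * (x powr s * Gamma x) = x powr (s + 1) * Gamma x"
      using eventually_gt_at_top[of 0] by eventually_elim (simp add: powr_add)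
    ultimately show ?thesis by (rule bigo_transfer)
  qed
  have down: "(\<lambda>x::real. Gamma (x + (s - 1))) \<in> O[at_top](\<lambda>x. x powr (s - 1) * Gamma x)"
    if "(\<lambda>x::real. Gamma (x + s)) \<in> O[at_top](\<lambda>x. x powr s * Gamma x)" for s
  proof -
    have "(\<lambda>x. (1 / (x + s - 1)) * Gamma (x + s)) \<in> O[at_top](\<lambda>x. (1 / x) * (x powr s * Gamma x))"
      by (intro landau_o.big.mult that) real_asymp
    moreover have "\<forall>\<^sub>F x in at_top. (1 / (x + s - 1)) * Gamma (x + s) = Gamma (x + (s - 1))"
      using eventually_gt_at_top[of "1-s"]
    proof eventually_elim
      case (elim x)
      then have nz: "x + (s - 1) \<notin> \<int>\<^sub>\<le>\<^sub>0" by (auto elim!: nonpos_Ints_cases)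
      have "x + (s - 1) + 1 = x + s" by simp
      then show ?case using Gamma_plus1[OF nz] elim by (simp add: add_diff_eq)
    qed
    moreover have "\<forall>\<^sub>F x in at_top. (1 / x) * (x powr s * Gamma x) = x powr (s - 1) * Gamma x"
      using eventually_gt_at_top[of 0] by eventually_elim (simp add: powr_diff)
    ultimately show ?thesis by (rule bigo_transfer)
  qed
  have "(\<lambda>x::real. Gamma (x + (frac a + of_int k))) \<in> O[at_top](\<lambda>x. x powr (frac a + of_int k) * Gamma x)" for k
  proof (induction k rule: int_induct[where k = 0])
    case base
    show ?case using frac[of "frac a"] frac_lt_1[of a] by simp
  next
    case (step1 i)
    show ?case using up[OF step1(2)] by (simp add: add.assoc)
  next
    case (step2 i)
    show ?case using down[OF step2(2)] by (simp add: diff_add_eq add_diff_eq)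
  qed
  from this[of "\<lfloor>a\<rfloor>"] show ?thesis by (simp add: frac_def)
qed

text \<open>D_c(0) contains 1/Gamma((1 - c)/2), whose argument moves to the left as c grows.
  Reflection trades it for Gamma((c + 1)/2) times a sine, and the sine is bounded by 1.\<close>

lemma norm_pcD_0_le:
  assumes "c > -1"
  shows "norm (pcD (of_real c) 0) \<le> 2 powr (c / 2) * Gamma ((c + 1) / 2)"
proof -
  let ?z = "of_real ((c + 1) / 2) :: complex"
  have pos: "Gamma ((c + 1) / 2) > 0" using assms by (intro Gamma_real_pos) auto
  have nz: "(c + 1) / 2 \<notin> \<int>\<^sub>\<le>\<^sub>0" using assms by (auto elim!: nonpos_Ints_cases)
  have "rGamma ?z * rGamma (1 - ?z) = of_real (sin (pi * ((c + 1) / 2)) / pi)"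
    using rGamma_reflection_complex[of ?z] by (simp flip: sin_of_real)
  then have "norm (rGamma ?z) * norm (rGamma (1 - ?z)) = \<bar>sin (pi * ((c + 1) / 2))\<bar> / pi"
    by (metis abs_divide abs_of_pos norm_mult norm_of_real pi_gt_zero)
  also have "rGamma ?z = of_real (inverse (Gamma ((c + 1) / 2)))"
    by (simp only: rGamma_complex_of_real) (simp only: rGamma_inverse_Gamma)
  also have "norm (complex_of_real (inverse (Gamma ((c + 1) / 2)))) = inverse (Gamma ((c + 1) / 2))"
    using pos by (simp only: norm_of_real) simp
  finally have "norm (rGamma (1 - ?z)) = Gamma ((c + 1) / 2) * (\<bar>sin (pi * ((c + 1) / 2))\<bar> / pi)"
    using pos by (simp add: field_simps)
  also have "\<dots> \<le> Gamma ((c + 1) / 2) * (1 / pi)"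
    using pos abs_sin_le_one by (intro mult_left_mono divide_right_mono) auto
  finally have r: "norm (rGamma (1 - ?z)) \<le> Gamma ((c + 1) / 2) * (1 / pi)" .
  have e: "1/2 - of_real c / 2 = 1 - ?z" by (simp add: field_simps)
  have "norm (pcD (of_real c) 0) = 2 powr (c / 2) * sqrt pi * norm (rGamma (1 - ?z))"
    unfolding pcD_0 e norm_mult by (simp add: norm_powr_real_powr)
  also have "\<dots> \<le> 2 powr (c / 2) * sqrt pi * (Gamma ((c + 1) / 2) * (1 / pi))"
    by (intro mult_left_mono r) auto
  also have "\<dots> = 2 powr (c / 2) * Gamma ((c + 1) / 2) * (sqrt pi / pi)" by simp
  also have "\<dots> \<le> 2 powr (c / 2) * Gamma ((c + 1) / 2) * 1"
  proof -
    have "sqrt pi \<le> pi" using pi_gt3 by (intro real_le_lsqrt) (auto simp: power2_eq_square mult_le_cancel_left1)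
    then show ?thesis using pos by (intro mult_left_mono) auto
  qed
  finally show ?thesis by simp
qed

text \<open>With x = (n + 1)/2 Legendre duplication reads 2^n Gamma(x) Gamma(x + 1/2) = sqrt(pi) n!.
  Lowering the second argument to x gains the power -1/2.\<close>

lemma Gamma_half_sq_bigo:
  "(\<lambda>n. 2 ^ n * Gamma ((real n + 1) / 2) ^ 2) \<in> O(\<lambda>n. fact n * real n powr (-1/2))"
proof -
  have lim: "filterlim (\<lambda>n. (real n + 1) / 2 + 1/2) at_top sequentially" by real_asymp
  have "(\<lambda>n. Gamma ((real n + 1) / 2 + 1/2 + (-1/2))) \<in>
      O(\<lambda>n. ((real n + 1) / 2 + 1/2) powr (-1/2) * Gamma ((real n + 1) / 2 + 1/2))"
    by (rule landau_o.big.compose[OF Gamma_add_bigo lim])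
  then have "(\<lambda>n. 2 ^ n * Gamma ((real n + 1) / 2) * Gamma ((real n + 1) / 2 + 1/2 + (-1/2))) \<in>
      O(\<lambda>n. 2 ^ n * Gamma ((real n + 1) / 2) * (((real n + 1) / 2 + 1/2) powr (-1/2) * Gamma ((real n + 1) / 2 + 1/2)))"
    by (intro landau_o.big.mult) auto
  also have "(\<lambda>n. 2 ^ n * Gamma ((real n + 1) / 2) * Gamma ((real n + 1) / 2 + 1/2 + (-1/2)))
      = (\<lambda>n. 2 ^ n * Gamma ((real n + 1) / 2) ^ 2)"
    by (simp add: power2_eq_square mult_ac)
  also have "(\<lambda>n. 2 ^ n * Gamma ((real n + 1) / 2) * (((real n + 1) / 2 + 1/2) powr (-1/2) * Gamma ((real n + 1) / 2 + 1/2)))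
      = (\<lambda>n. fact n * (sqrt pi * ((real n + 1) / 2 + 1/2) powr (-1/2)))"
  proof
    fix n
    let ?x = "(real n + 1) / 2"
    have nz: "complex_of_real ?x \<notin> \<int>\<^sub>\<le>\<^sub>0" "complex_of_real ?x + 1/2 \<notin> \<int>\<^sub>\<le>\<^sub>0"
      by (intro Re_pos_not_nonpos_Int; simp add: add_pos_nonneg)+
    have "complex_of_real (Gamma ?x * Gamma (?x + 1/2)) = Gamma (of_real ?x) * Gamma (of_real ?x + 1/2)"
      by (simp only: of_real_mult Gamma_complex_of_real[symmetric]) simp
    also have "\<dots> = exp ((1 - 2 * of_real ?x) * of_real (ln 2)) * of_real (sqrt pi) * Gamma (2 * of_real ?x)"
      by (rule Gamma_legendre_duplication[OF nz])
    also have "1 - 2 * complex_of_real ?x = of_real (- real n)" by (simp add: field_simps)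
    also have "2 * complex_of_real ?x = 1 + of_nat n" by (simp add: field_simps)
    also have "exp (of_real (- real n) * complex_of_real (ln 2)) * of_real (sqrt pi) * Gamma (1 + of_nat n)
        = of_real (exp (- real n * ln 2) * sqrt pi * fact n)"
      by (simp add: Gamma_fact exp_of_real[symmetric])
    finally have "Gamma ?x * Gamma (?x + 1/2) = exp (- real n * ln 2) * sqrt pi * fact n"
      using of_real_eq_iff by blast
    also have "exp (- real n * ln 2) = 1 / 2 ^ n"
      by (simp add: exp_minus exp_of_nat_mult divide_inverse)
    finally have *: "2 ^ n * (Gamma ?x * Gamma (?x + 1/2)) = sqrt pi * fact n" by simp
    have "2 ^ n * Gamma ?x * ((?x + 1/2) powr (-1/2) * Gamma (?x + 1/2))
        = (2 ^ n * (Gamma ?x * Gamma (?x + 1/2))) * (?x + 1/2) powr (-1/2)"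
      by (simp only: mult_ac)
    also have "\<dots> = fact n * (sqrt pi * (?x + 1/2) powr (-1/2))"
      unfolding * by (simp only: mult_ac)
    finally show "2 ^ n * Gamma ?x * ((?x + 1/2) powr (-1/2) * Gamma (?x + 1/2)) = fact n * (sqrt pi * (?x + 1/2) powr (-1/2))" .
  qed
  also have "(\<lambda>n. fact n * (sqrt pi * ((real n + 1) / 2 + 1/2) powr (-1/2))) \<in> O(\<lambda>n. fact n * real n powr (-1/2))"
    by (intro landau_o.big.mult) (simp, real_asymp)
  finally show ?thesis .
qed

lemma Gamma_shift_sq_bigo:
  "(\<lambda>n. 2 ^ n * Gamma ((real n + 1) / 2 + a) ^ 2) \<in> O(\<lambda>n. fact n * real n powr (2 * a - 1/2))"
proof -
  have lim: "filterlim (\<lambda>n. (real n + 1) / 2) at_top sequentially" by real_asymp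
  have "(\<lambda>n. Gamma ((real n + 1) / 2 + a) ^ 2) \<in> O(\<lambda>n. (((real n + 1) / 2) powr a * Gamma ((real n + 1) / 2)) ^ 2)"
    unfolding power2_eq_square by (intro landau_o.big.mult landau_o.big.compose[OF Gamma_add_bigo lim])
  then have "(\<lambda>n. 2 ^ n * Gamma ((real n + 1) / 2 + a) ^ 2)
      \<in> O(\<lambda>n. 2 ^ n * (((real n + 1) / 2) powr a * Gamma ((real n + 1) / 2)) ^ 2)"
    by (intro landau_o.big.mult) auto
  also have "(\<lambda>n. 2 ^ n * (((real n + 1) / 2) powr a * Gamma ((real n + 1) / 2)) ^ 2)
     = (\<lambda>n. (((real n + 1) / 2) powr a) ^ 2 * (2 ^ n * Gamma ((real n + 1) / 2) ^ 2))"
    by (simp add: power_mult_distrib mult_ac)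
  also have "\<dots> \<in> O(\<lambda>n. (real n powr a) ^ 2 * (fact n * real n powr (-1/2)))"
    by (intro landau_o.big.mult Gamma_half_sq_bigo) real_asymp
  also have "(\<lambda>n. (real n powr a) ^ 2 * (fact n * real n powr (-1/2))) \<in> O(\<lambda>n. fact n * real n powr (2 * a - 1/2))"
  proof (rule bigoI[of _ 1])
    show "\<forall>\<^sub>F n in sequentially. norm ((real n powr a) ^ 2 * (fact n * real n powr (-1/2))) \<le> 1 * norm (fact n * real n powr (2 * a - 1/2))"
    proof (intro always_eventually allI)
      fix n
      have "(real n powr a) ^ 2 * real n powr (-1/2) = real n powr (2 * a - 1/2)"
        by (simp add: power2_eq_square powr_add[symmetric])
      then show "norm ((real n powr a) ^ 2 * (fact n * real n powr (-1/2))) \<le> 1 * norm (fact n * real n powr (2 * a - 1/2))"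
        by (simp add: abs_mult power_mult_distrib mult.left_commute)
    qed
  qed
  finally show ?thesis .
qed

text \<open>The square of D_(b+n)(0) is smaller by one power of n than that of D_(b+n+1)(0), and its
  factor b + n + 1/2 makes up for exactly this.\<close>

lemma pcD_energy_bigo:
  "(\<lambda>n. pcD_energy (b + real n)) \<in> O(\<lambda>n. fact n * real n powr (b + 1/2))"
proof -
  let ?A = "\<lambda>n. 2 ^ n * Gamma ((real n + 1) / 2 + (b + 1) / 2) ^ 2"
  let ?B = "\<lambda>n. 2 ^ n * Gamma ((real n + 1) / 2 + b / 2) ^ 2"
  have "(\<lambda>n. pcD_energy (b + real n)) \<in> O(\<lambda>n. 2 powr (b + 1) * ?A n + (b + real n + 1/2) * (2 powr b * ?B n))"
  proof (rule bigoI[of _ 1])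
    have "\<forall>\<^sub>F n in sequentially. real n > - b" by real_asymp
    then show "\<forall>\<^sub>F n in sequentially. norm (pcD_energy (b + real n)) \<le> 1 * norm (2 powr (b + 1) * ?A n + (b + real n + 1/2) * (2 powr b * ?B n))"
    proof eventually_elim
      case (elim n)
      have p: "(2 powr (c / 2)) ^ 2 = 2 powr c" for c :: real
        by (simp add: power2_eq_square powr_add[symmetric])
      have 1: "norm (pcD (of_real (b + real n) + 1) 0) ^ 2 \<le> 2 powr (b + 1) * ?A n"
      proof -
        have "norm (pcD (of_real (b + real n + 1)) 0) ^ 2 \<le> (2 powr ((b + real n + 1) / 2) * Gamma ((b + real n + 1 + 1) / 2)) ^ 2"
          using elim by (intro power_mono norm_pcD_0_le) auto
        also have "\<dots> = 2 powr (b + 1) * ?A n"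
          unfolding power_mult_distrib p by (simp add: powr_add powr_realpow add_divide_distrib add_ac)
        finally show ?thesis by simp
      qed
      have 2: "norm (pcD (of_real (b + real n)) 0) ^ 2 \<le> 2 powr b * ?B n"
      proof -
        have "norm (pcD (of_real (b + real n)) 0) ^ 2 \<le> (2 powr ((b + real n) / 2) * Gamma ((b + real n + 1) / 2)) ^ 2"
          using elim by (intro power_mono norm_pcD_0_le) auto
        also have "\<dots> = 2 powr b * ?B n"
          unfolding power_mult_distrib p by (simp add: powr_add powr_realpow add_divide_distrib add_ac)
        finally show ?thesis .
      qed
      have "pcD_energy (b + real n) \<le> 2 powr (b + 1) * ?A n + (b + real n + 1/2) * (2 powr b * ?B n)"
        unfolding pcD_energy_def using elim by (intro add_mono mult_left_mono 1 2) auto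
      moreover have "pcD_energy (b + real n) \<ge> 0" using elim by (intro pcD_energy_nonneg) auto
      ultimately show ?case by simp
    qed
  qed
  also have "(\<lambda>n. 2 powr (b + 1) * ?A n + (b + real n + 1/2) * (2 powr b * ?B n)) \<in> O(\<lambda>n. fact n * real n powr (b + 1/2))"
  proof (rule sum_in_bigo)
    show "(\<lambda>n. 2 powr (b + 1) * ?A n) \<in> O(\<lambda>n. fact n * real n powr (b + 1/2))"
      proof -
      have e: "2 * ((b + 1) / 2) - 1/2 = b + 1/2" by simp
      show ?thesis using Gamma_shift_sq_bigo[of "(b + 1) / 2"] unfolding e by simp
    qed
    have "(\<lambda>n. (b + real n + 1/2) * (2 powr b * ?B n)) \<in> O(\<lambda>n. real n * (fact n * real n powr (b - 1/2)))"
    proof (rule landau_o.big.mult)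
      show "(\<lambda>n. b + real n + 1/2) \<in> O(\<lambda>n. real n)" by real_asymp
      show "(\<lambda>n. 2 powr b * ?B n) \<in> O(\<lambda>n. fact n * real n powr (b - 1/2))"
        using Gamma_shift_sq_bigo[of "b / 2"] by simp
    qed
    also have "\<forall>\<^sub>F n in sequentially. real n * (fact n * real n powr (b - 1/2)) = fact n * real n powr (b + 1/2)"
      using eventually_gt_at_top[of 0]
    proof eventually_elim
      case (elim n)
      have "real n * real n powr (b - 1/2) = real n powr (1 + (b - 1/2))"
        by (simp add: powr_mult_base)
      also have "1 + (b - 1/2) = b + 1/2" by simp
      finally show ?case by (simp only: mult.left_commute)
    qed
    then have "O(\<lambda>n. real n * (fact n * real n powr (b - 1/2))) = O(\<lambda>n. fact n * real n powr (b + 1/2))"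
      by (rule landau_o.big.cong)
    finally show "(\<lambda>n. (b + real n + 1/2) * (2 powr b * ?B n)) \<in> O(\<lambda>n. fact n * real n powr (b + 1/2))" .
  qed
  finally show ?thesis .
qed

lemma bigo_of_square:
  fixes f g :: "nat \<Rightarrow> real"
  assumes "(\<lambda>n. f n ^ 2) \<in> O(\<lambda>n. g n ^ 2)"
  shows "f \<in> O(g)"
proof -
  obtain c where c: "c > 0" "\<forall>\<^sub>F n in sequentially. norm (f n ^ 2) \<le> c * norm (g n ^ 2)"
    using assms by (auto elim!: landau_o.bigE)
  show ?thesis
  proof (rule bigoI[of _ "sqrt c"])
    show "\<forall>\<^sub>F n in sequentially. norm (f n) \<le> sqrt c * norm (g n)"
      using c(2)
    proof eventually_elim
      case (elim n)
      then have "sqrt (f n ^ 2) \<le> sqrt (c * g n ^ 2)" by (intro real_sqrt_le_mono) simp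
      then show ?case by (simp only: real_sqrt_mult real_sqrt_abs real_norm_def)
    qed
  qed
qed

lemma sqrt_fact_powr_sq: "(sqrt (fact n) * real n powr a) ^ 2 = fact n * real n powr (2 * a)"
  unfolding power_mult_distrib by (simp add: power2_eq_square powr_add[symmetric])

lemma pcD_bigo:
  assumes "x \<ge> 0"
  shows "(\<lambda>n. norm (pcD (of_real b + of_nat n) x)) \<in> O(\<lambda>n. sqrt (fact n) * real n powr (b / 2 - 1/4))"
proof (rule bigo_of_square)
  have "(\<lambda>n. norm (pcD (of_real b + of_nat n) x) ^ 2) \<in> O(\<lambda>n. pcD_energy (b + real n) * (1 / (b + real n + 1/2 - x ^ 2 / 4)))"
  proof (rule bigoI[of _ 1])
    have "\<forall>\<^sub>F n in sequentially. real n > - b + x ^ 2 / 4" by real_asymp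
    then show "\<forall>\<^sub>F n in sequentially. norm (norm (pcD (of_real b + of_nat n) x) ^ 2) \<le> 1 * norm (pcD_energy (b + real n) * (1 / (b + real n + 1/2 - x ^ 2 / 4)))"
    proof eventually_elim
      case (elim n)
      then have "b + real n + 1/2 - x ^ 2 / 4 > 0" by simp
      moreover have "pcD_energy (b + real n) \<ge> 0"
        using elim zero_le_power2[of x] by (intro pcD_energy_nonneg) linarith
      ultimately show ?case using pcD_le_energy_pointwise[OF assms, of "b + real n"] by simp
    qed
  qed
  also have "(\<lambda>n. pcD_energy (b + real n) * (1 / (b + real n + 1/2 - x ^ 2 / 4))) \<in> O(\<lambda>n. fact n * real n powr (b + 1/2) * (1 / real n))"
    by (intro landau_o.big.mult pcD_energy_bigo) real_asymp
  also have "\<forall>\<^sub>F n in sequentially. fact n * real n powr (b + 1/2) * (1 / real n) = (sqrt (fact n) * real n powr (b / 2 - 1/4)) ^ 2"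
    using eventually_gt_at_top[of 0]
  proof eventually_elim
    case (elim n)
    have "real n powr (b + 1/2) * (1 / real n) = real n powr (b + 1/2 - 1)"
      by (subst powr_diff) simp
    also have "b + 1/2 - 1 = 2 * (b / 2 - 1/4)" by simp
    finally show ?case by (simp only: sqrt_fact_powr_sq mult.assoc)
  qed
  then have "O(\<lambda>n. fact n * real n powr (b + 1/2) * (1 / real n)) = O(\<lambda>n. (sqrt (fact n) * real n powr (b / 2 - 1/4)) ^ 2)"
    by (rule landau_o.big.cong)
  finally show "(\<lambda>n. norm (pcD (of_real b + of_nat n) x) ^ 2) \<in> O(\<lambda>n. (sqrt (fact n) * real n powr (b / 2 - 1/4)) ^ 2)" .
qed

text \<open>Here the energy is multiplied by n where \<open>pcD_bigo\<close> divides it by n; after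
  the square root this is the loss of one full power of n.\<close>

lemma pcD_sup_bigo:
  "(\<lambda>n. pcD_sup (of_real b + of_nat n)) \<in> O(\<lambda>n. sqrt (fact n) * real n powr (b / 2 + 3/4))"
proof (rule bigo_of_square)
  have "(\<lambda>n. pcD_sup (of_real b + of_nat n) ^ 2) \<in> O(\<lambda>n. (9 * (b + real n + 1/2)) * pcD_energy (b + real n))"
  proof (rule bigoI[of _ 1])
    have "\<forall>\<^sub>F n in sequentially. real n > - b + 1" by real_asymp
    then show "\<forall>\<^sub>F n in sequentially. norm (pcD_sup (of_real b + of_nat n) ^ 2) \<le> 1 * norm ((9 * (b + real n + 1/2)) * pcD_energy (b + real n))"
    proof eventually_elim
      case (elim n)
      then have 1: "b + real n \<ge> 1/2" "pcD_energy (b + real n) \<ge> 0" by (auto intro: pcD_energy_nonneg)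
      have "pcD_sup (of_real b + of_nat n) ^ 2 \<le> (3 * sqrt (b + real n + 1/2) * sqrt (pcD_energy (b + real n))) ^ 2"
        using pcD_sup_le_energy[OF 1(1)] pcD_sup_nonneg by (intro power_mono) simp_all
      also have "\<dots> = (9 * (b + real n + 1/2)) * pcD_energy (b + real n)"
        using 1 by (simp add: power_mult_distrib)
      finally show ?case using 1 by simp
    qed
  qed
  also have "(\<lambda>n. (9 * (b + real n + 1/2)) * pcD_energy (b + real n)) \<in> O(\<lambda>n. real n * (fact n * real n powr (b + 1/2)))"
    by (intro landau_o.big.mult pcD_energy_bigo) real_asymp
  also have "\<forall>\<^sub>F n in sequentially. real n * (fact n * real n powr (b + 1/2)) = (sqrt (fact n) * real n powr (b / 2 + 3/4)) ^ 2"
    using eventually_gt_at_top[of 0]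
  proof eventually_elim
    case (elim n)
    have "real n * real n powr (b + 1/2) = real n powr (1 + (b + 1/2))"
      by (simp add: powr_mult_base)
    also have "1 + (b + 1/2) = 2 * (b / 2 + 3/4)" by simp
    finally show ?case by (simp only: sqrt_fact_powr_sq mult.left_commute)
  qed
  then have "O(\<lambda>n. real n * (fact n * real n powr (b + 1/2))) = O(\<lambda>n. (sqrt (fact n) * real n powr (b / 2 + 3/4)) ^ 2)"
    by (rule landau_o.big.cong)
  finally show "(\<lambda>n. pcD_sup (of_real b + of_nat n) ^ 2) \<in> O(\<lambda>n. (sqrt (fact n) * real n powr (b / 2 + 3/4)) ^ 2)" .
qed

section \<open>Series in the order\<close>

text \<open>The Weierstrass test for the derivatives yields the uniform convergence of linear maps
  that \<open>has_derivative_series\<close> asks for, since scaling a fixed vector has that vector's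
  norm as operator norm.\<close>

lemma has_vector_derivative_suminf:
  fixes f :: "nat \<Rightarrow> real \<Rightarrow> 'a :: banach"
  assumes S: "convex S" "x \<in> S"
    and f: "\<And>n x. x \<in> S \<Longrightarrow> (f n has_vector_derivative f' n x) (at x within S)"
    and f': "\<And>n x. x \<in> S \<Longrightarrow> norm (f' n x) \<le> M n"
    and M: "summable M"
    and summable: "\<And>x. x \<in> S \<Longrightarrow> summable (\<lambda>n. f n x)"
  shows "((\<lambda>x. \<Sum>n. f n x) has_vector_derivative (\<Sum>n. f' n x)) (at x within S)"
proof -
  have unif: "uniform_limit S (\<lambda>n x. \<Sum>i<n. f' i x) (\<lambda>x. \<Sum>i. f' i x) sequentially"
    by (rule Weierstrass_m_test[OF f' M])
  have "\<exists>g. \<forall>x\<in>S. (\<lambda>n. f n x) sums g x \<and> (g has_derivative (\<lambda>h. h *\<^sub>R (\<Sum>i. f' i x))) (at x within S)"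
  proof (rule has_derivative_series[where f = f and f' = "\<lambda>n x h. h *\<^sub>R f' n x" and g' = "\<lambda>x h. h *\<^sub>R (\<Sum>i. f' i x)"])
    show "convex S" "x \<in> S" "(\<lambda>n. f n x) sums (\<Sum>n. f n x)"
      using S summable by auto
   
    show "(f n has_derivative (\<lambda>h. h *\<^sub>R f' n x)) (at x within S)" if "x \<in> S" for n x
      using f[OF that] by (simp add: has_vector_derivative_def)
    fix e :: real assume "e > 0"
    then have "\<forall>\<^sub>F n in sequentially. \<forall>x\<in>S. dist (\<Sum>i<n. f' i x) (\<Sum>i. f' i x) < e"
      using unif by (simp add: uniform_limit_iff)
    then show "\<forall>\<^sub>F n in sequentially. \<forall>x\<in>S. \<forall>h. norm ((\<Sum>i<n. h *\<^sub>R f' i x) - h *\<^sub>R (\<Sum>i. f' i x)) \<le> e * norm h"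
    proof eventually_elim
      case (elim n)
      show ?case
      proof (intro ballI allI)
        fix x and h :: real assume "x \<in> S"
        have "norm ((\<Sum>i<n. h *\<^sub>R f' i x) - h *\<^sub>R (\<Sum>i. f' i x)) = norm h * norm ((\<Sum>i<n. f' i x) - (\<Sum>i. f' i x))"
          by (simp flip: scaleR_sum_right scaleR_diff_right)
        also have "\<dots> \<le> norm h * e"
          using elim \<open>x \<in> S\<close> by (intro mult_left_mono) (auto simp: dist_norm less_imp_le)
        finally show "norm ((\<Sum>i<n. h *\<^sub>R f' i x) - h *\<^sub>R (\<Sum>i. f' i x)) \<le> e * norm h"
          by (simp add: mult.commute)
      qed
    qed
  qed
  then obtain g where g: "\<And>x. x \<in> S \<Longrightarrow> (\<lambda>n. f n x) sums g x"
    "\<And>x. x \<in> S \<Longrightarrow> (g has_vector_derivative (\<Sum>i. f' i x)) (at x within S)"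
    unfolding has_vector_derivative_def by blast
  show ?thesis
    by (rule has_vector_derivative_transform[OF S(2) _ g(2)[OF S(2)]]) (use g(1) in \<open>auto simp: sums_iff\<close>)
qed

lemma norm_pcD'_le:
  assumes "0 \<le> x" "x \<le> R"
  shows "norm (pcD' a x) \<le> R * pcD_sup a + pcD_sup (a + 1)"
proof -
  have "norm (pcD' a x) \<le> norm (of_real x / 2 * pcD a x) + norm (pcD (a + 1) x)"
    unfolding pcD'_def by (rule norm_triangle_ineq4)
  also have "\<dots> = x / 2 * norm (pcD a x) + norm (pcD (a + 1) x)"
    using assms by (simp add: norm_mult norm_divide)
  also have "\<dots> \<le> R * pcD_sup a + pcD_sup (a + 1)"
    using assms by (intro add_mono mult_mono pcD_le_sup) auto
  finally show ?thesis .
qed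

text \<open>Series in the order of \<open>D\<close>, differentiated termwise. The bounds are uniform on the half line,
  because the argument by convexity needs a bounded sum.\<close>

locale pcD_series =
  fixes \<alpha> :: "nat \<Rightarrow> complex" and b :: real
  assumes summable_sup: "summable (\<lambda>n. norm (\<alpha> n) * pcD_sup (of_real b + of_nat n))"
    and summable_sup_Suc: "summable (\<lambda>n. norm (\<alpha> n) * pcD_sup (of_real b + of_nat n + 1))"
begin

definition U :: "real \<Rightarrow> complex" where "U x = (\<Sum>n. \<alpha> n * pcD (of_real b + of_nat n) x)"
definition U' :: "real \<Rightarrow> complex" where "U' x = (\<Sum>n. \<alpha> n * pcD' (of_real b + of_nat n) x)"

lemma norm_term_le:
  "x \<ge> 0 \<Longrightarrow> norm (\<alpha> n * pcD (of_real b + of_nat n) x) \<le> norm (\<alpha> n) * pcD_sup (of_real b + of_nat n)"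
  by (simp add: norm_mult mult_left_mono pcD_le_sup)

lemma norm_term'_le:
  assumes "0 \<le> x" "x \<le> R"
  shows "norm (\<alpha> n * pcD' (of_real b + of_nat n) x)
     \<le> R * (norm (\<alpha> n) * pcD_sup (of_real b + of_nat n)) + norm (\<alpha> n) * pcD_sup (of_real b + of_nat n + 1)"
proof -
  have "norm (\<alpha> n * pcD' (of_real b + of_nat n) x)
     \<le> norm (\<alpha> n) * (R * pcD_sup (of_real b + of_nat n) + pcD_sup (of_real b + of_nat n + 1))"
    unfolding norm_mult by (intro mult_left_mono norm_pcD'_le assms) auto
  then show ?thesis by (simp add: algebra_simps)
qed

lemma summable_U: "x \<ge> 0 \<Longrightarrow> summable (\<lambda>n. \<alpha> n * pcD (of_real b + of_nat n) x)"
  by (rule summable_comparison_test'[OF summable_sup norm_term_le])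

lemma summable_bound': 
  "summable (\<lambda>n. R * (norm (\<alpha> n) * pcD_sup (of_real b + of_nat n)) + norm (\<alpha> n) * pcD_sup (of_real b + of_nat n + 1))"
  by (intro summable_add summable_mult summable_sup summable_sup_Suc)

lemma summable_U': "x \<ge> 0 \<Longrightarrow> summable (\<lambda>n. \<alpha> n * pcD' (of_real b + of_nat n) x)"
  by (rule summable_comparison_test'[OF summable_bound'[of x] norm_term'_le]) auto

lemma norm_U_le: "x \<ge> 0 \<Longrightarrow> norm (U x) \<le> (\<Sum>n. norm (\<alpha> n) * pcD_sup (of_real b + of_nat n))"
  unfolding U_def by (rule norm_suminf_le[OF norm_term_le summable_sup])

lemma continuous_on_U: "continuous_on {0..} U"
proof -
  have "uniform_limit {0..} (\<lambda>n x. \<Sum>i<n. \<alpha> i * pcD (of_real b + of_nat i) x) U sequentially"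
    unfolding U_def[abs_def] by (rule Weierstrass_m_test[OF norm_term_le summable_sup]) auto
  then show ?thesis
    by (rule uniform_limit_theorem[rotated]) (auto intro!: always_eventually continuous_intros continuous_on_pcD)
qed

text \<open>The factor x/2 in D' is unbounded on the half line, so the majorant is set up on a
  compact interval that has x in its interior.\<close>

lemma has_vector_derivative_U:
  assumes "x > 0"
  shows "(U has_vector_derivative U' x) (at x)"
proof -
  have "(U has_vector_derivative U' x) (at x within {0..x + 1})"
    unfolding U_def[abs_def] U'_def
    by (rule has_vector_derivative_suminf[OF _ _ _ norm_term'_le[where R = "x + 1"] summable_bound'])
       (use assms in \<open>auto intro!: derivative_eq_intros has_vector_derivative_pcD summable_U\<close>)
  then show ?thesis
    using assms by (subst (asm) at_within_interior) auto
qed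

text \<open>The second derivative of the n-th term carries the coefficient x^2/4 - (b + n + 1/2),
  which grows like n; this is where summability with an extra factor n enters.\<close>

lemma has_vector_derivative_U':
  assumes summable_n: "summable (\<lambda>n. real n * (norm (\<alpha> n) * pcD_sup (of_real b + of_nat n)))"
    and "x > 0"
  shows "(U' has_vector_derivative
      (\<Sum>n. \<alpha> n * (of_real (x ^ 2 / 4) * pcD (of_real b + of_nat n) x - (of_real b + of_nat n + 1/2) * pcD (of_real b + of_nat n) x))) (at x)"
proof -
  define M where "M = (\<lambda>n. ((x + 1) ^ 2 / 4 + \<bar>b\<bar> + 1/2) * (norm (\<alpha> n) * pcD_sup (of_real b + of_nat n))
                       + real n * (norm (\<alpha> n) * pcD_sup (of_real b + of_nat n)))"
  have "(U' has_vector_derivative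
      (\<Sum>n. \<alpha> n * (of_real (x ^ 2 / 4) * pcD (of_real b + of_nat n) x - (of_real b + of_nat n + 1/2) * pcD (of_real b + of_nat n) x)))
      (at x within {0..x + 1})"
    unfolding U'_def[abs_def]
  proof (rule has_vector_derivative_suminf[where M = M])
    show "summable M" unfolding M_def by (intro summable_add summable_mult summable_n summable_sup)
    fix n t assume t: "t \<in> {0..x + 1}"
    show "((\<lambda>t. \<alpha> n * pcD' (of_real b + of_nat n) t) has_vector_derivative
       \<alpha> n * (of_real (t ^ 2 / 4) * pcD (of_real b + of_nat n) t - (of_real b + of_nat n + 1/2) * pcD (of_real b + of_nat n) t)) (at t within {0..x + 1})"
      by (intro has_vector_derivative_mult_right has_vector_derivative_pcD')
    have c: "norm (of_real (t ^ 2 / 4) - (of_real b + of_nat n + 1/2) :: complex) \<le> (x + 1) ^ 2 / 4 + \<bar>b\<bar> + 1/2 + real n"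
    proof -
      have "of_real (t ^ 2 / 4) - (of_real b + of_nat n + 1/2) = complex_of_real (t ^ 2 / 4 - (b + real n + 1/2))" by simp
      then have "norm (of_real (t ^ 2 / 4) - (of_real b + of_nat n + 1/2) :: complex) = \<bar>t ^ 2 / 4 - (b + real n + 1/2)\<bar>"
        by (simp only: norm_of_real)
      moreover have "0 \<le> t ^ 2 / 4" by simp
      moreover have "t ^ 2 \<le> (x + 1) ^ 2" using t by (intro power_mono) auto
      ultimately show ?thesis by linarith
    qed
    have "\<alpha> n * (of_real (t ^ 2 / 4) * pcD (of_real b + of_nat n) t - (of_real b + of_nat n + 1/2) * pcD (of_real b + of_nat n) t)
        = (of_real (t ^ 2 / 4) - (of_real b + of_nat n + 1/2)) * (\<alpha> n * pcD (of_real b + of_nat n) t)"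
      by (simp only: left_diff_distrib right_diff_distrib mult_ac)
    also have "norm \<dots> \<le> ((x + 1) ^ 2 / 4 + \<bar>b\<bar> + 1/2 + real n) * (norm (\<alpha> n) * pcD_sup (of_real b + of_nat n))"
      unfolding norm_mult[of "_ - _"] using t by (intro mult_mono c norm_term_le) auto
    also have "\<dots> = M n" by (simp add: M_def algebra_simps)
    finally show "norm (\<alpha> n * (of_real (t ^ 2 / 4) * pcD (of_real b + of_nat n) t - (of_real b + of_nat n + 1/2) * pcD (of_real b + of_nat n) t)) \<le> M n" .
  qed (use assms in \<open>auto intro: summable_U'\<close>)
  then show ?thesis
    using assms by (subst (asm) at_within_interior) auto
qed

end

section \<open>The terms A_n(b), their size and their recurrences\<close>

definition pcA :: "real \<Rightarrow> real \<Rightarrow> real \<Rightarrow> nat \<Rightarrow> complex" where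
  "pcA z y b n = (-1) ^ n / fact n * pcD (of_nat n) z * pcD (of_real b + of_nat n) y"

text \<open>The 1/n! absorbs the factor sqrt(n!) of each of the two cylinder functions, so only the
  powers of n decide.\<close>

lemma summable_bigo_fact:
  fixes f g h :: "nat \<Rightarrow> real"
  assumes "f \<in> O(\<lambda>n. sqrt (fact n) * real n powr p)" "g \<in> O(\<lambda>n. sqrt (fact n) * real n powr q)"
    "h \<in> O(\<lambda>n. real n powr r)"
  shows bigo_fact: "(\<lambda>n. h n * (f n / fact n * g n)) \<in> O(\<lambda>n. real n powr (p + q + r))"
    and "p + q + r < -1 \<Longrightarrow> summable (\<lambda>n. h n * (f n / fact n * g n))"
proof -
  have "(\<lambda>n. h n * (f n * (1 / fact n) * g n)) \<in>
      O(\<lambda>n. real n powr r * (sqrt (fact n) * real n powr p * (1 / fact n) * (sqrt (fact n) * real n powr q)))"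
    by (intro landau_o.big.mult assms) auto
  also have "(\<lambda>n. real n powr r * (sqrt (fact n) * real n powr p * (1 / fact n) * (sqrt (fact n) * real n powr q)))
      = (\<lambda>n. real n powr (p + q + r))"
  proof
    fix n :: nat
    have "real n powr r * (sqrt (fact n) * real n powr p * (1 / fact n) * (sqrt (fact n) * real n powr q))
        = (sqrt (fact n) * sqrt (fact n) / fact n) * (real n powr p * real n powr q * real n powr r)"
      by (simp only: mult_ac times_divide_eq_right times_divide_eq_left mult_1_left mult_1_right)
    also have "\<dots> = real n powr (p + q + r)" by (simp add: powr_add)
    finally show "real n powr r * (sqrt (fact n) * real n powr p * (1 / fact n) * (sqrt (fact n) * real n powr q)) = real n powr (p + q + r)" .
  qed
  finally show *: "(\<lambda>n. h n * (f n / fact n * g n)) \<in> O(\<lambda>n. real n powr (p + q + r))" by simp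
  show "summable (\<lambda>n. h n * (f n / fact n * g n))" if "p + q + r < -1"
    by (rule summable_comparison_test_bigo[OF _ *]) (use that in \<open>simp add: summable_real_powr_iff\<close>)
qed

lemma norm_pcA: "norm (pcA z y b n) = norm (pcD (of_nat n) z) / fact n * norm (pcD (of_real b + of_nat n) y)"
  by (simp add: pcA_def norm_mult norm_divide norm_power)

lemma pcA_bigo:
  assumes "z \<ge> 0" "y \<ge> 0"
  shows "(\<lambda>n. norm (pcA z y b n)) \<in> O(\<lambda>n. real n powr (b / 2 - 1/2))"
  using bigo_fact[OF pcD_bigo[OF assms(1), of 0] pcD_bigo[OF assms(2), of b], of "\<lambda>_. 1" 0]
  by (simp add: norm_pcA eventually_gt_at_top landau_o.big.in_cong)

lemma summable_pcA:
  assumes "z \<ge> 0" "y \<ge> 0" "b < -1"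
  shows "summable (\<lambda>n. norm (pcA z y b n))"
  by (rule summable_comparison_test_bigo[OF _ pcA_bigo[OF assms(1,2)]]) (use assms in \<open>simp add: summable_real_powr_iff\<close>)

lemma pcA_tendsto_0:
  assumes "z \<ge> 0" "y \<ge> 0" "b < 1"
  shows "pcA z y b \<longlonglongrightarrow> 0"
proof -
  have *: "(\<lambda>n. real n powr (b / 2 - 1/2)) \<longlonglongrightarrow> 0" using assms by real_asymp
  from pcA_bigo[OF assms(1,2), of b]
  obtain c where "\<forall>\<^sub>F n in sequentially. norm (norm (pcA z y b n)) \<le> c * norm (real n powr (b / 2 - 1/2))"
    by (rule landau_o.bigE)
  then have "\<forall>\<^sub>F n in sequentially. norm (pcA z y b n) \<le> c * real n powr (b / 2 - 1/2)"
    by simp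
  then show ?thesis
    using tendsto_mult_right_zero[OF *, of c] by (rule Lim_null_comparison)
qed

text \<open>The index n - 1, with 0 before the beginning. Recurrences that reach A_(n-1) or A_(n-2)
  then hold for every n, and shifting leaves sums unchanged.\<close>

definition pred_seq :: "(nat \<Rightarrow> complex) \<Rightarrow> nat \<Rightarrow> complex" where
  "pred_seq f n = (if n = 0 then 0 else f (n - 1))"

lemma pred_seq_simps [simp]: "pred_seq f 0 = 0" "pred_seq f (Suc n) = f n"
  by (simp_all add: pred_seq_def)

lemma sums_pred_seq: "f sums s \<Longrightarrow> pred_seq f sums s"
  using sums_Suc_iff[of "pred_seq f" s] by simp

lemma pred_seq_tendsto: "f \<longlonglongrightarrow> l \<Longrightarrow> pred_seq f \<longlonglongrightarrow> l"
  using filterlim_sequentially_Suc[of "pred_seq f"] by simp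

lemma sums_pred_seq_diff:
  assumes "f \<longlonglongrightarrow> 0"
  shows "(\<lambda>n. f n - pred_seq f n) sums 0"
proof -
  have "(\<Sum>i<n. f i - pred_seq f i) = pred_seq f n" for n
    by (induction n) auto
  then show ?thesis using pred_seq_tendsto[OF assms] by (simp add: sums_def)
qed

text \<open>This is z D_n = D_(n+1) + n D_(n-1) in the first factor. The order b + n of the second
  factor must stay fixed, so b moves opposite to n; both neighbours change the sign (-1)^n.\<close>

lemma pcA_z_recurrence:
  "of_real z * pcA z y b n = - of_nat (Suc n) * pcA z y (b - 1) (Suc n) - pred_seq (pcA z y (b + 1)) n"
proof -
  have r: "of_real z * pcD (of_nat n) z = pcD (of_nat (Suc n)) z + of_nat n * pcD (of_nat n - 1) z"
    using pcD_recurrence[of "of_nat n" z] by (simp add: add.commute)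
  have "of_real z * pcA z y b n = (-1) ^ n / fact n * (of_real z * pcD (of_nat n) z) * pcD (of_real b + of_nat n) y"
    by (simp only: pcA_def mult_ac)
  also have "\<dots> = (-1) ^ n / fact n * pcD (of_nat (Suc n)) z * pcD (of_real b + of_nat n) y
      + (-1) ^ n / fact n * of_nat n * pcD (of_nat n - 1) z * pcD (of_real b + of_nat n) y"
    unfolding r by (simp only: distrib_left distrib_right mult.assoc)
  also have "(-1) ^ n / fact n * pcD (of_nat (Suc n)) z * pcD (of_real b + of_nat n) y = - of_nat (Suc n) * pcA z y (b - 1) (Suc n)"
  proof -
    have "of_nat (Suc n) * ((-1) ^ Suc n / fact (Suc n)) = - ((-1) ^ n / fact n :: complex)"
      by (simp del: of_nat_Suc)
    moreover have "of_real (b - 1) + of_nat (Suc n) = (of_real b + of_nat n :: complex)" by simp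
    ultimately show ?thesis unfolding pcA_def by (metis minus_mult_left minus_minus mult.assoc)
  qed
  also have "(-1) ^ n / fact n * of_nat n * pcD (of_nat n - 1) z * pcD (of_real b + of_nat n) y = - pred_seq (pcA z y (b + 1)) n"
  proof (cases n)
    case (Suc m)
    have "(-1) ^ Suc m / fact (Suc m) * of_nat (Suc m) = - ((-1) ^ m / fact m :: complex)"
      by (simp del: of_nat_Suc)
    moreover have "of_real b + of_nat (Suc m) = (of_real (b + 1) + of_nat m :: complex)"
      "of_nat (Suc m) - 1 = (of_nat m :: complex)" by simp_all
    ultimately show ?thesis using Suc by (simp only: pred_seq_simps pcA_def mult_minus_left)
  qed simp
  finally show ?thesis by simp
qed

lemma pcA_y_recurrence:
  "pcA z y b n = of_real y * pcA z y (b - 1) n - (of_real b + of_nat n - 1) * pcA z y (b - 2) n"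
proof -
  have "pcD (of_real b + of_nat n) y = of_real y * pcD (of_real (b - 1) + of_nat n) y
      - (of_real b + of_nat n - 1) * pcD (of_real (b - 2) + of_nat n) y"
    using pcD_recurrence[of "of_real (b - 1) + of_nat n" y] by (simp add: algebra_simps)
  then show ?thesis unfolding pcA_def by (simp only: right_diff_distrib mult_ac)
qed

text \<open>The y-recurrence brings in n A_n(b - 2), and the z-recurrence at the preceding index
  removes the factor n. Besides multiples of y and z there remains A_n(b) - A_(n-2)(b), written as
  two consecutive differences so that it telescopes.\<close>

lemma pcA_telescope:
  "of_real (b - 1) * pcA z y (b - 2) n = of_real y * pcA z y (b - 1) n + of_real z * pred_seq (pcA z y (b - 1)) n
      - ((pcA z y b n - pred_seq (pcA z y b) n) + (pred_seq (pcA z y b) n - pred_seq (pred_seq (pcA z y b)) n))"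
proof -
  have 1: "of_nat n * pcA z y (b - 2) n = - of_real z * pred_seq (pcA z y (b - 1)) n - pred_seq (pred_seq (pcA z y b)) n"
  proof (cases n)
    case (Suc m)
    have "of_real z * pcA z y (b - 1) m = - of_nat (Suc m) * pcA z y (b - 2) (Suc m) - pred_seq (pcA z y b) m"
      using pcA_z_recurrence[of z y "b - 1" m] by simp
    then show ?thesis using Suc by (simp del: of_nat_Suc)
  qed simp
  have "of_real (b - 1) * pcA z y (b - 2) n = of_real y * pcA z y (b - 1) n - pcA z y b n - of_nat n * pcA z y (b - 2) n"
    using pcA_y_recurrence[of z y b n] by (simp add: algebra_simps)
  then show ?thesis unfolding 1 by simp
qed

text \<open>Summation of \<open>pcA_telescope\<close>; the boundary terms vanish because A_n(b)
  tends to 0. The disjunction admits y = z = 0, where the right-hand side is 0 whatever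
  \<open>s\<close> is and no convergence at b - 1 has to be known.\<close>

lemma pcA_sums_lower:
  assumes "z \<ge> 0" "y \<ge> 0" "b < 1"
    and "of_real (y + z) = (0::complex) \<or> pcA z y (b - 1) sums s"
  shows "(\<lambda>n. of_real (b - 1) * pcA z y (b - 2) n) sums (of_real (y + z) * s)"
proof -
  note lim = pcA_tendsto_0[OF assms(1-3)]
  have "(\<lambda>n. (pcA z y b n - pred_seq (pcA z y b) n) + (pred_seq (pcA z y b) n - pred_seq (pred_seq (pcA z y b)) n)) sums (0 + 0)"
    by (intro sums_add sums_pred_seq_diff lim pred_seq_tendsto)
  moreover have "(\<lambda>n. of_real y * pcA z y (b - 1) n + of_real z * pred_seq (pcA z y (b - 1)) n) sums (of_real y * s + of_real z * s)"
  proof (cases "y + z = 0")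
    case True
    then have "y = 0" "z = 0" using assms by auto
    then show ?thesis by simp
  next
    case False
    then have "pcA z y (b - 1) sums s" using assms(4) by (metis of_real_eq_0_iff)
    then show ?thesis by (intro sums_add sums_mult sums_pred_seq)
  qed
  ultimately have "(\<lambda>n. of_real (b - 1) * pcA z y (b - 2) n) sums (of_real y * s + of_real z * s - (0 + 0))"
    unfolding pcA_telescope by (rule sums_diff[rotated])
  then show ?thesis by (simp add: algebra_simps)
qed

section \<open>The constant\<close>

text \<open>As 1/(k + s) is the integral of t^(k+s-1) over (0,1), the sum is the integral of t^(s-1)
  times the binomial series of (1 - t)^(-c), which is a Beta integral. The absolutely summable
  coefficients provide the majorant.\<close>

lemma gauss_sum_real:
  fixes c s :: real
  assumes c: "c < 1" and s: "s > 0"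
    and summable: "summable (\<lambda>k. \<bar>pochhammer c k / fact k\<bar>)"
  shows "(\<lambda>k. pochhammer c k / fact k / (real k + s)) sums Beta s (1 - c)"
proof -
  define \<beta> where "\<beta> = (\<lambda>k. pochhammer c k / fact k)"
  define f where "f = (\<lambda>N t. \<Sum>k<N. \<beta> k * t powr (real k + s - 1))"
  define g where "g = (\<lambda>t. t powr (s - 1) * (1 - t) powr (- c) :: real)"
  define h where "h = (\<lambda>t. t powr (s - 1) * (\<Sum>k. \<bar>\<beta> k\<bar>) :: real)"
  have sb: "summable (\<lambda>k. \<bar>\<beta> k\<bar>)" using summable by (simp add: \<beta>_def)
  have sb': "summable (\<lambda>k. \<beta> k / (real k + s))"
  proof (rule summable_comparison_test)
    show "summable (\<lambda>k. \<bar>\<beta> k\<bar> / s)" by (rule summable_divide[OF sb])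
    show "\<exists>N. \<forall>n\<ge>N. norm (\<beta> n / (real n + s)) \<le> \<bar>\<beta> n\<bar> / s"
      using s by (intro exI[of _ 0]) (auto simp: abs_divide intro!: divide_left_mono)
  qed
  have I: "(g has_integral (\<Sum>k. \<beta> k / (real k + s))) {0<..<1}"
  proof (rule has_integral_dominated_convergence)
    show "(f N has_integral (\<Sum>k<N. \<beta> k / (real k + s))) {0<..<1}" for N
    proof -
      have "((\<lambda>t. t powr (real k + s - 1)) has_integral (1 / (real k + s))) {0<..<1}" for k
        using has_integral_powr_from_0[of "real k + s - 1" 1] s by (simp add: has_integral_Icc_iff_Ioo)
      from has_integral_mult_right[OF this]
      have "((\<lambda>t. \<beta> k * t powr (real k + s - 1)) has_integral (\<beta> k / (real k + s))) {0<..<1}" for k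
        by simp
      then show ?thesis unfolding f_def by (intro has_integral_sum) auto
    qed
    have "((\<lambda>t. t powr (s - 1)) has_integral (1 / s)) {0<..<1::real}"
      using has_integral_powr_from_0[of "s - 1" 1] s by (simp add: has_integral_Icc_iff_Ioo)
    then show "h integrable_on {0<..<1}"
      unfolding h_def by (intro integrable_on_mult_left) auto
    show "\<forall>t\<in>{0<..<1}. norm (f N t) \<le> h t" for N
    proof
      fix t :: real assume t: "t \<in> {0<..<1}"
      have "norm (f N t) \<le> (\<Sum>k<N. norm (\<beta> k * t powr (real k + s - 1)))"
        unfolding f_def by (rule norm_sum)
      also have "\<dots> \<le> (\<Sum>k<N. \<bar>\<beta> k\<bar> * t powr (s - 1))"
        using t by (intro sum_mono) (auto simp: abs_mult intro!: mult_left_mono powr_mono')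
      also have "\<dots> = t powr (s - 1) * (\<Sum>k<N. \<bar>\<beta> k\<bar>)"
        by (simp add: sum_distrib_left mult.commute)
      also have "\<dots> \<le> h t"
        unfolding h_def by (intro mult_left_mono sum_le_suminf sb) auto
      finally show "norm (f N t) \<le> h t" .
    qed
    show "\<forall>t\<in>{0<..<1}. (\<lambda>N. f N t) \<longlonglongrightarrow> g t"
    proof
      fix t :: real assume t: "t \<in> {0<..<1}"
      have "(\<lambda>k. ((-c) gchoose k) * (-t) ^ k) sums (1 + (-t)) powr (-c)"
        using t by (intro gen_binomial_real) auto
      moreover have "((-c) gchoose k) * (-t) ^ k = \<beta> k * t ^ k" for k
      proof -
        have "((-c) gchoose k) * (-t) ^ k = ((-1) ^ k * (-1) ^ k) * (pochhammer c k / fact k * t ^ k)"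
          unfolding gbinomial_pochhammer power_minus[of t] by simp
        also have "(-1) ^ k * (-1) ^ k = (1::real)" by (simp flip: power_mult_distrib)
        finally show ?thesis by (simp add: \<beta>_def)
      qed
      ultimately have "(\<lambda>k. \<beta> k * t ^ k * t powr (s - 1)) sums ((1 - t) powr (-c) * t powr (s - 1))"
        by (intro sums_mult2) simp
      moreover have e: "\<beta> k * t ^ k * t powr (s - 1) = \<beta> k * t powr (real k + s - 1)" for k
        using t by (simp add: powr_realpow[symmetric] powr_add[symmetric] add_diff_eq)
      ultimately show "(\<lambda>N. f N t) \<longlonglongrightarrow> g t"
        unfolding f_def g_def sums_def e by (simp only: mult.commute)
    qed
    show "(\<lambda>N. \<Sum>k<N. \<beta> k / (real k + s)) \<longlonglongrightarrow> (\<Sum>k. \<beta> k / (real k + s))"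
      using summable_LIMSEQ[OF sb'] .
  qed
  have "(g has_integral Beta s (1 - c)) {0<..<1}"
    using has_integral_Beta_real[of s "1 - c"] s c by (simp add: has_integral_Icc_iff_Ioo g_def)
  with I have "(\<Sum>k. \<beta> k / (real k + s)) = Beta s (1 - c)"
    by (rule has_integral_unique)
  then show ?thesis using summable_sums[OF sb'] by (simp add: \<beta>_def)
qed

text \<open>Analytic continuation from real s in [1,2]. On Re s > 1/2 the denominators stay above
  1/2 in modulus, so convergence is uniform; with s = \<nu>/2 this half plane is Re \<nu> >
  1.\<close>

lemma gauss_sum:
  fixes c :: real and s :: complex
  assumes c: "c < 1" and s: "Re s > 1/2"
    and summable: "summable (\<lambda>k. \<bar>pochhammer c k / fact k\<bar>)"
  shows "(\<lambda>k. of_real (pochhammer c k / fact k) / (of_nat k + s)) sums (Gamma s * of_real (Gamma (1 - c)) * rGamma (s + of_real (1 - c)))"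
proof -
  define \<beta> where "\<beta> = (\<lambda>k. pochhammer c k / fact k)"
  define H where "H = {s. Re s > 1/2}"
  define S where "S = (\<lambda>s. \<Sum>k. of_real (\<beta> k) / (of_nat k + s) :: complex)"
  define R where "R = (\<lambda>s. Gamma s * of_real (Gamma (1 - c)) * rGamma (s + of_real (1 - c)) :: complex)"
  have sb: "summable (\<lambda>k. \<bar>\<beta> k\<bar> * 2)" unfolding \<beta>_def by (rule summable_mult2[OF summable])
  have H: "open H" "convex H" unfolding H_def
    by (rule open_halfspace_Re_gt convex_halfspace_Re_gt)+
  have le: "norm (of_real (\<beta> k) / (of_nat k + s) :: complex) \<le> \<bar>\<beta> k\<bar> * 2" if "s \<in> H" for k s
  proof -
    have "1/2 \<le> Re (of_nat k + s)" using that by (simp add: H_def)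
    also have "\<dots> \<le> norm (of_nat k + s)" by (rule complex_Re_le_cmod)
    finally have "\<bar>\<beta> k\<bar> / norm (of_nat k + s) \<le> \<bar>\<beta> k\<bar> / (1/2)" by (intro divide_left_mono) auto
    then show ?thesis by (simp add: norm_divide)
  qed
  have unif: "uniform_limit H (\<lambda>n s. \<Sum>k<n. of_real (\<beta> k) / (of_nat k + s)) S sequentially"
    unfolding S_def[abs_def] by (rule Weierstrass_m_test[OF le sb])
  have nz: "of_nat k + s \<noteq> 0" if "s \<in> H" for k s
    using that by (auto simp: H_def complex_eq_iff)
  have holS: "S holomorphic_on H"
  proof (rule holomorphic_uniform_sequence[OF H(1)])
    show "(\<lambda>s. \<Sum>k<n. of_real (\<beta> k) / (of_nat k + s)) holomorphic_on H" for n
      by (intro holomorphic_intros) (use nz in auto)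
    fix x assume "x \<in> H"
    then obtain d where "d > 0" "cball x d \<subseteq> H" using H(1) open_contains_cball by blast
    then show "\<exists>d>0. cball x d \<subseteq> H \<and> uniform_limit (cball x d) (\<lambda>n s. \<Sum>k<n. of_real (\<beta> k) / (of_nat k + s)) S sequentially"
      using uniform_limit_on_subset[OF unif] by blast
  qed
  have holR: "R holomorphic_on H"
    unfolding R_def by (intro holomorphic_intros) (auto simp: H_def intro!: Re_pos_not_nonpos_Int)
  have "S s - R s = 0"
  proof (rule analytic_continuation[where f = "\<lambda>s. S s - R s" and S = H and U = "complex_of_real ` {1..2}" and \<xi> = 1])
    show "(\<lambda>s. S s - R s) holomorphic_on H" by (intro holomorphic_intros holS holR)
    show "connected H" using H(2) by (rule convex_connected)
    show "complex_of_real ` {1..2} \<subseteq> H" by (auto simp: H_def)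
    show "(1::complex) islimpt complex_of_real ` {1..2}"
    proof -
      define f where "f = (\<lambda>n. complex_of_real (1 + 1 / real (Suc n)))"
      have "(\<lambda>n. 1 + 1 / real (Suc n)) \<longlonglongrightarrow> 1" by real_asymp
      then have "f \<longlonglongrightarrow> of_real 1" unfolding f_def by (rule tendsto_of_real)
      then have 1: "f \<longlonglongrightarrow> 1" by simp
      have 2: "f n \<in> complex_of_real ` {1..2} - {1}" for n
      proof -
        have "1 + 1 / real (Suc n) \<in> {1..2}" "f n \<noteq> of_real 1"
          unfolding f_def of_real_eq_iff by (simp_all add: divide_simps)
        then show ?thesis unfolding f_def of_real_1 by blast
      qed
      show ?thesis unfolding islimpt_sequential using 1 2 by metis
    qed
    fix w assume "w \<in> complex_of_real ` {1..2}"
    then obtain r where w: "w = of_real r" "1 \<le> r" by auto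
    have "(\<lambda>k. \<beta> k / (real k + r)) sums Beta r (1 - c)"
      using gauss_sum_real[OF c _ summable, of r] w by (simp add: \<beta>_def)
    then have "(\<lambda>k. complex_of_real (\<beta> k / (real k + r))) sums of_real (Beta r (1 - c))"
      by (rule sums_of_real)
    then have "S w = of_real (Beta r (1 - c))"
      by (simp add: S_def w sums_iff)
    also have "\<dots> = R w"
      using w c by (simp add: R_def Beta_altdef Gamma_complex_of_real rGamma_complex_of_real flip: of_real_diff of_real_add)
    finally show "S w - R w = 0" by simp
  qed (use s H in \<open>auto simp: H_def\<close>)
  moreover have "summable (\<lambda>k. of_real (\<beta> k) / (of_nat k + s) :: complex)"
    by (rule summable_comparison_test'[OF sb le]) (use s in \<open>auto simp: H_def\<close>)
  ultimately show ?thesis by (simp add: S_def R_def \<beta>_def sums_iff)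
qed

section \<open>Values at the origin\<close>

lemma pcD_0_shift: "pcD (a + 1) 0 = - a * pcD (a - 1) 0"
  using pcD_recurrence[of a 0] by simp

lemma pcD_0_0: "pcD 0 0 = 1"
  by (simp add: pcD_0 rGamma_inverse_Gamma Gamma_one_half_complex)

lemma pcD_odd_0: "pcD (of_nat (Suc (2 * k))) 0 = 0"
proof (induction k)
  case 0
  show ?case by (simp add: pcD_0)
next
  case (Suc k)
  show ?case using pcD_0_shift[of "of_nat (Suc (Suc (2 * k)))"] Suc by simp
qed

lemma pcA_0_odd: "n \<notin> range ((*) 2) \<Longrightarrow> pcA 0 0 b n = 0"
  using pcD_odd_0 by (cases "even n") (auto simp: pcA_def elim!: evenE oddE simp del: of_nat_Suc)

text \<open>From k to k + 1 the two values at 0 acquire the factors -(2k + 1) and -(b + 2k + 1). The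
  signs cancel, and 2k + 1 is cancelled by the factorial, which leaves the ratio of consecutive
  binomial series coefficients with parameter (b + 1)/2.\<close>

lemma pcA_0_even:
  "pcA 0 0 b (2 * k) = pcD (of_real b) 0 * of_real (pochhammer ((b + 1) / 2) k / fact k)"
proof (induction k)
  case 0
  show ?case by (simp add: pcA_def pcD_0_0)
next
  case (Suc k)
  have 1: "pcD (of_nat (2 * Suc k)) 0 = - of_nat (2 * k + 1) * pcD (of_nat (2 * k)) 0"
    using pcD_0_shift[of "of_nat (2 * k + 1)"] by (simp add: add_ac)
  have 2: "pcD (of_real b + of_nat (2 * Suc k)) 0 = - of_real (b + real (2 * k + 1)) * pcD (of_real b + of_nat (2 * k)) 0"
    using pcD_0_shift[of "of_real b + of_nat (2 * k + 1)"] by (simp add: add_ac)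
  have 3: "(fact (2 * Suc k) :: complex) = of_nat (2 * k + 2) * (of_nat (2 * k + 1) * fact (2 * k))"
    by (simp add: algebra_simps)
  have nz: "complex_of_nat (2 * k + 1) \<noteq> 0" "complex_of_nat (2 * k + 2) \<noteq> 0"
    by (simp_all only: of_nat_eq_0_iff)
  have "pcA 0 0 b (2 * Suc k) = of_real (b + real (2 * k + 1)) / of_nat (2 * k + 2) * pcA 0 0 b (2 * k)"
  proof -
    have "1 / (N * (M * F)) * (- M * X) * (- r * Y) = r / N * (1 / F * X * Y)" if "M \<noteq> 0" for M N F X Y r :: complex
      using that by simp
    moreover have "(-1) ^ (2 * Suc k) = (1::complex)" "(-1) ^ (2 * k) = (1::complex)"
      unfolding power_mult by simp_all
    ultimately show ?thesis unfolding pcA_def 1 2 3 using nz(1) by (simp only:) 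
  qed
  also have "of_real (b + real (2 * k + 1)) / of_nat (2 * k + 2) = complex_of_real (((b + 1) / 2 + real k) / real (Suc k))"
  proof -
    have "(b + real (2 * k + 1)) / real (2 * k + 2) = ((b + 1) / 2 + real k) / real (Suc k)"
      by (simp add: field_simps)
    then show ?thesis by (metis of_real_divide of_real_of_nat_eq)
  qed
  also have "\<dots> * pcA 0 0 b (2 * k)
      = pcD (of_real b) 0 * of_real (((b + 1) / 2 + real k) / real (Suc k) * (pochhammer ((b + 1) / 2) k / fact k))"
    unfolding Suc by (simp only: of_real_mult mult_ac)
  also have "((b + 1) / 2 + real k) / real (Suc k) * (pochhammer ((b + 1) / 2) k / fact k)
      = pochhammer ((b + 1) / 2) (Suc k) / fact (Suc k)"
    unfolding pochhammer_Suc fact_Suc by (simp add: mult_ac)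
  finally show ?case .
qed

lemma pcD_0_nonzero: "Re a < 1 \<Longrightarrow> pcD a 0 \<noteq> 0"
  using Re_pos_not_nonpos_Int[of "1/2 - a/2"] by (simp add: pcD_0 rGamma_eq_zero_iff)

text \<open>Only even n = 2k contribute, and 1/(2k + \<nu>) is half of 1/(k + \<nu>/2), which is
  \<open>gauss_sum\<close> with s = \<nu>/2. There Gamma(1 - c) cancels the reciprocal Gamma in
  D_b(0), and duplication at \<nu>/2 produces both Gamma(\<nu>) and the reciprocal Gamma in
  D_(-\<nu>)(0).\<close>

lemma pcA_series_at_0:
  assumes b: "b < -1" and \<nu>: "Re \<nu> > 1"
  shows "(\<lambda>n. pcA 0 0 b n / (of_nat n + \<nu>)) sums (Gamma \<nu> * pcD (- \<nu>) 0 * pcD (of_real b - \<nu>) 0)"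
proof -
  define c where "c = (b + 1) / 2"
  have D: "pcD (of_real b) 0 \<noteq> 0" using b by (intro pcD_0_nonzero) auto
  \<comment> \<open>The binomial coefficients inherit absolute summability from the terms A_n(b) at
    the origin, since D_b(0) is not 0.\<close>
  have "summable (\<lambda>k. norm (pcA 0 0 b (2 * k)))"
    using summable_pcA[of 0 0 b] b
    by (intro summable_mono_reindex[THEN iffD2, of "(*) 2" "\<lambda>n. norm (pcA 0 0 b n)"])
       (auto simp: strict_mono_def pcA_0_odd)
  then have "summable (\<lambda>k. norm (pcD (of_real b) 0) * \<bar>pochhammer c k / fact k\<bar>)"
    unfolding pcA_0_even norm_mult norm_of_real c_def[symmetric] .
  then have sb: "summable (\<lambda>k. \<bar>pochhammer c k / fact k\<bar>)"
    by (rule summable_mult_D) (use D in simp)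
  let ?s = "\<nu> / 2"
  have "(\<lambda>k. of_real (pochhammer c k / fact k) / (of_nat k + ?s)) sums (Gamma ?s * of_real (Gamma (1 - c)) * rGamma (?s + of_real (1 - c)))"
    using b \<nu> by (intro gauss_sum sb) (auto simp: c_def)
  from sums_mult[OF this, of "pcD (of_real b) 0 / 2"]
  have "(\<lambda>k. pcA 0 0 b (2 * k) / (of_nat (2 * k) + \<nu>)) sums (pcD (of_real b) 0 / 2 * (Gamma ?s * of_real (Gamma (1 - c)) * rGamma (?s + of_real (1 - c))))"
  proof (rule sums_cong[THEN iffD1, rotated])
    fix k
    have "of_nat (2 * k) + \<nu> = 2 * (of_nat k + ?s)" by (simp add: algebra_simps)
    then show "pcD (of_real b) 0 / 2 * (of_real (pochhammer c k / fact k) / (of_nat k + ?s)) = pcA 0 0 b (2 * k) / (of_nat (2 * k) + \<nu>)"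
      unfolding pcA_0_even c_def[symmetric] by (simp only: times_divide_times_eq)
  qed
  then have *: "(\<lambda>n. pcA 0 0 b n / (of_nat n + \<nu>)) sums (pcD (of_real b) 0 / 2 * (Gamma ?s * of_real (Gamma (1 - c)) * rGamma (?s + of_real (1 - c))))"
    by (subst (asm) sums_mono_reindex[of "(*) 2" "\<lambda>n. pcA 0 0 b n / (of_nat n + \<nu>)"])
       (auto simp: strict_mono_def pcA_0_odd)
  have e1: "1/2 - of_real b / 2 = complex_of_real (1 - c)" by (simp add: c_def field_simps)
  have e2: "1/2 - (of_real b - \<nu>) / 2 = ?s + of_real (1 - c)" by (simp add: c_def field_simps)
  have G: "complex_of_real (Gamma (1 - c)) * rGamma (of_real (1 - c)) = 1"
  proof -
    have "complex_of_real (1 - c) \<notin> \<int>\<^sub>\<le>\<^sub>0" using b by (intro Re_pos_not_nonpos_Int) (simp add: c_def)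
    then show ?thesis
      by (simp only: Gamma_complex_of_real[symmetric] rGamma_inverse_Gamma) (simp add: Gamma_eq_zero_iff)
  qed
  have p: "(2::complex) powr ((of_real b - \<nu>)/2) = 2 powr (of_real b / 2) * 2 powr (- \<nu> / 2)"
    by (simp add: powr_add[symmetric] diff_divide_distrib)
  have nz: "?s \<notin> \<int>\<^sub>\<le>\<^sub>0" "?s + 1/2 \<notin> \<int>\<^sub>\<le>\<^sub>0" using \<nu> by (auto intro!: Re_pos_not_nonpos_Int)
  have dup: "Gamma ?s * Gamma (?s + 1/2) = 2 * 2 powr (- \<nu>) * of_real (sqrt pi) * Gamma \<nu>"
  proof -
    have "exp ((1 - 2 * ?s) * of_real (ln 2)) = (2::complex) powr (1 + - \<nu>)"
      by (simp add: powr_def Ln_of_real[symmetric])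
    then show ?thesis using Gamma_legendre_duplication[OF nz] by (simp only: powr_add) simp
  qed
  have "Gamma ?s = Gamma ?s * (Gamma (?s + 1/2) * rGamma (?s + 1/2))"
    using nz(2) by (simp add: rGamma_inverse_Gamma Gamma_eq_zero_iff)
  also have "\<dots> = 2 * (Gamma \<nu> * 2 powr (- \<nu> / 2) * 2 powr (- \<nu> / 2) * of_real (sqrt pi) * rGamma (1/2 + ?s))"
    unfolding mult.assoc[symmetric] dup by (simp add: powr_add[symmetric] add.commute mult_ac)
  finally have Gs: "Gamma ?s = 2 * (Gamma \<nu> * 2 powr (- \<nu> / 2) * 2 powr (- \<nu> / 2) * of_real (sqrt pi) * rGamma (1/2 + ?s))" .
  have "pcD (of_real b) 0 / 2 * (Gamma ?s * of_real (Gamma (1 - c)) * rGamma (?s + of_real (1 - c)))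
     = 2 powr (of_real b / 2) * of_real (sqrt pi) / 2 * Gamma ?s * rGamma (?s + of_real (1 - c)) * (of_real (Gamma (1 - c)) * rGamma (of_real (1 - c)))"
    unfolding pcD_0 e1 by simp
  also have "\<dots> = Gamma \<nu> * pcD (- \<nu>) 0 * pcD (of_real b - \<nu>) 0"
    unfolding G Gs pcD_0 e2 p by (simp add: mult_ac)
  finally show ?thesis using * by simp
qed

section \<open>The expansion\<close>

text \<open>The combination u D_a(0) - u(0) D_a is a bounded solution that vanishes at 0, and its
  modulus cannot increase. The condition on Re a makes the coefficient x^2/4 - (a + 1/2) have
  nonnegative real part on the whole half line.\<close>

lemma pcD_proportional:
  assumes u: "\<And>x. x > 0 \<Longrightarrow> (u has_vector_derivative u' x) (at x)"
    and u': "\<And>x. x > 0 \<Longrightarrow> (u' has_vector_derivative of_real (x ^ 2 / 4) * u x - (a + 1/2) * u x) (at x)"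
    and cont: "continuous_on {0..} u"
    and bdd: "\<And>x. x \<ge> 0 \<Longrightarrow> norm (u x) \<le> B"
    and a: "Re a \<le> -1/2" and x: "x \<ge> 0"
  shows "u x * pcD a 0 = u 0 * pcD a x"
proof -
  define v where "v = (\<lambda>x. u x * pcD a 0 - u 0 * pcD a x)"
  define v' where "v' = (\<lambda>x. u' x * pcD a 0 - u 0 * pcD' a x)"
  have "norm (v x) \<le> norm (v 0)"
  proof (rule bounded_ode_norm_nonincreasing[where c = 0 and q = "\<lambda>t. of_real (t ^ 2 / 4) - (a + 1/2)"])
    fix t :: real assume t: "0 < t"
    show "(v has_vector_derivative v' t) (at t)"
      unfolding v_def v'_def
      by (intro has_vector_derivative_diff has_vector_derivative_mult_right has_vector_derivative_mult_left u t has_vector_derivative_pcD)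
    have "(v' has_vector_derivative
        (of_real (t ^ 2 / 4) * u t - (a + 1/2) * u t) * pcD a 0 - u 0 * (of_real (t ^ 2 / 4) * pcD a t - (a + 1/2) * pcD a t)) (at t)"
      unfolding v'_def
      by (intro has_vector_derivative_diff has_vector_derivative_mult_right has_vector_derivative_mult_left u' t has_vector_derivative_pcD')
    then show "(v' has_vector_derivative (of_real (t ^ 2 / 4) - (a + 1/2)) * v t) (at t)"
      by (simp add: v_def algebra_simps)
    have "Re (of_real (t ^ 2 / 4) - (a + 1/2)) = t ^ 2 / 4 - (Re a + 1/2)" by simp
    also have "\<dots> \<ge> 0" using a zero_le_power2[of t] by linarith
    finally show "0 \<le> Re (of_real (t ^ 2 / 4) - (a + 1/2))" .
    have "norm (v t) \<le> norm (u t * pcD a 0) + norm (u 0 * pcD a t)"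
      unfolding v_def by (rule norm_triangle_ineq4)
    also have "\<dots> \<le> B * norm (pcD a 0) + norm (u 0) * pcD_sup a"
      unfolding norm_mult using t by (intro add_mono mult_mono bdd pcD_le_sup) (auto intro: order_trans[OF norm_ge_zero bdd])
    finally show "norm (v t) \<le> B * norm (pcD a 0) + norm (u 0) * pcD_sup a" .
  next
    show "continuous_on {0..} v"
      unfolding v_def by (intro continuous_intros cont continuous_on_pcD)
  qed (use x in auto)
  then show ?thesis by (simp add: v_def)
qed

text \<open>By \<open>zero\<close> the factor n in the termwise second derivative may be replaced by
  -\<kappa>, so U solves Weber's equation of order b - \<kappa>. The bound on Re \<kappa> places
  this order in the range of \<open>pcD_proportional\<close>.\<close>

lemma (in pcD_series) U_proportional:
  assumes summable_n: "summable (\<lambda>n. real n * (norm (\<alpha> n) * pcD_sup (of_real b + of_nat n)))"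
    and zero: "\<And>x. x > 0 \<Longrightarrow> (\<lambda>n. (of_nat n + \<kappa>) * (\<alpha> n * pcD (of_real b + of_nat n) x)) sums 0"
    and \<kappa>: "Re \<kappa> \<ge> b + 1/2" and x: "x \<ge> 0"
  shows "U x * pcD (of_real b - \<kappa>) 0 = U 0 * pcD (of_real b - \<kappa>) x"
proof (rule pcD_proportional[OF has_vector_derivative_U _ continuous_on_U norm_U_le])
  fix x :: real assume x: "x > 0"
  have "(\<lambda>n. (of_real (x ^ 2 / 4) - (of_real b - \<kappa> + 1/2)) * (\<alpha> n * pcD (of_real b + of_nat n) x)
        - (of_nat n + \<kappa>) * (\<alpha> n * pcD (of_real b + of_nat n) x)) sums
        ((of_real (x ^ 2 / 4) - (of_real b - \<kappa> + 1/2)) * U x - 0)"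
    unfolding U_def using x by (intro sums_diff sums_mult summable_sums summable_U zero) auto
  then have "(\<Sum>n. \<alpha> n * (of_real (x ^ 2 / 4) * pcD (of_real b + of_nat n) x - (of_real b + of_nat n + 1/2) * pcD (of_real b + of_nat n) x))
     = of_real (x ^ 2 / 4) * U x - (of_real b - \<kappa> + 1/2) * U x"
    by (simp add: sums_iff algebra_simps)
  with has_vector_derivative_U'[OF summable_n x]
  show "(U' has_vector_derivative of_real (x ^ 2 / 4) * U x - (of_real b - \<kappa> + 1/2) * U x) (at x)" by simp
qed (use assms in auto)

text \<open>The weight \<open>w\<close> is 1 for G and 1/(n + \<nu>) for T. With the extra factor n
  the exponents add up to -1/4 + (b/2 + 3/4) + 1, which is below -1 exactly when b < -5.\<close>

lemma pcD_series_y: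
  assumes z: "z \<ge> 0" and b: "b < -5" and w: "(\<lambda>n. norm (w n)) \<in> O(\<lambda>_. 1)"
  defines "\<alpha> \<equiv> \<lambda>n. w n * ((-1) ^ n / fact n * pcD (of_nat n) z)"
  shows "pcD_series \<alpha> b"
    and "summable (\<lambda>n. real n * (norm (\<alpha> n) * pcD_sup (of_real b + of_nat n)))"
proof -
  have \<alpha>: "norm (\<alpha> n) = norm (w n) * (norm (pcD (of_nat n) z) / fact n)" for n
    by (simp add: \<alpha>_def norm_mult norm_divide norm_power)
  have D: "(\<lambda>n. norm (pcD (of_nat n) z)) \<in> O(\<lambda>n. sqrt (fact n) * real n powr (- 1/4))"
    using pcD_bigo[OF z, of 0] by simp
  have w0: "(\<lambda>n. norm (w n)) \<in> O(\<lambda>n. real n powr 0)"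
    using w by (rule landau_o.big_trans) real_asymp
  have w1: "(\<lambda>n. real n * norm (w n)) \<in> O(\<lambda>n. real n powr 1)"
    using landau_o.big.mult[OF landau_o.big_refl[of real] w] by simp
  show "pcD_series \<alpha> b"
  proof
    show "summable (\<lambda>n. norm (\<alpha> n) * pcD_sup (of_real b + of_nat n))"
      using summable_bigo_fact(2)[OF D pcD_sup_bigo[of b] w0] b by (simp add: \<alpha> mult_ac)
    show "summable (\<lambda>n. norm (\<alpha> n) * pcD_sup (of_real b + of_nat n + 1))"
      using summable_bigo_fact(2)[OF D pcD_sup_bigo[of "b + 1"] w0] b by (simp add: \<alpha> mult_ac add_ac field_simps)
  qed
  show "summable (\<lambda>n. real n * (norm (\<alpha> n) * pcD_sup (of_real b + of_nat n)))"
    using summable_bigo_fact(2)[OF D pcD_sup_bigo[of b] w1] b by (simp add: \<alpha> mult_ac)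
qed

text \<open>The arguments exchange roles: the pointwise bound is used at order b + n, the uniform
  one at order n. The total exponent is the same as in \<open>pcD_series_y\<close>.\<close>

lemma pcD_series_z:
  assumes y: "y \<ge> 0" and b: "b < -5" and w: "(\<lambda>n. norm (w n)) \<in> O(\<lambda>_. 1)"
  defines "\<alpha> \<equiv> \<lambda>n. w n * ((-1) ^ n / fact n * pcD (of_real b + of_nat n) y)"
  shows "pcD_series \<alpha> 0"
    and "summable (\<lambda>n. real n * (norm (\<alpha> n) * pcD_sup (of_real 0 + of_nat n)))"
proof -
  have \<alpha>: "norm (\<alpha> n) = norm (w n) * (norm (pcD (of_real b + of_nat n) y) / fact n)" for n
    by (simp add: \<alpha>_def norm_mult norm_divide norm_power)
  note D = pcD_bigo[OF y, of b]
  have w0: "(\<lambda>n. norm (w n)) \<in> O(\<lambda>n. real n powr 0)"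
    using w by (rule landau_o.big_trans) real_asymp
  have w1: "(\<lambda>n. real n * norm (w n)) \<in> O(\<lambda>n. real n powr 1)"
    using landau_o.big.mult[OF landau_o.big_refl[of real] w] by simp
  show "pcD_series \<alpha> 0"
  proof
    show "summable (\<lambda>n. norm (\<alpha> n) * pcD_sup (of_real 0 + of_nat n))"
      using summable_bigo_fact(2)[OF D pcD_sup_bigo[of 0] w0] b by (simp add: \<alpha> mult_ac)
    show "summable (\<lambda>n. norm (\<alpha> n) * pcD_sup (of_real 0 + of_nat n + 1))"
      using summable_bigo_fact(2)[OF D pcD_sup_bigo[of 1] w0] b by (simp add: \<alpha> mult_ac add_ac)
  qed
  show "summable (\<lambda>n. real n * (norm (\<alpha> n) * pcD_sup (of_real 0 + of_nat n)))"
    using summable_bigo_fact(2)[OF D pcD_sup_bigo[of 0] w1] b by (simp add: \<alpha> mult_ac)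
qed

text \<open>The raising form of D' brings in the sum at b + 1, and \<open>pcA_sums_lower\<close> at
  b + 2 expresses that sum through the one at b. This closes the first order equation in y.\<close>

lemma pcA_sums_0_aux:
  assumes z: "z \<ge> 0" and y: "y \<ge> 0" and b: "b < -5"
  shows "pcA z y b sums 0"
proof -
  define \<alpha> where "\<alpha> = (\<lambda>n. (-1) ^ n / fact n * pcD (of_nat n) z)"
  interpret pcD_series \<alpha> b
    using pcD_series_y(1)[OF z b, of "\<lambda>_. 1"] by (simp add: \<alpha>_def)
  have A: "\<alpha> n * pcD (of_real b + of_nat n) t = pcA z t b n" for n t
    by (simp add: \<alpha>_def pcA_def)
  have U: "pcA z t b sums U t" if "t \<ge> 0" for t
    using summable_sums[OF summable_U[OF that]] by (simp add: A U_def)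
  have U': "U' t = (of_real (t / 2) - of_real ((b + 1) / (t + z))) * U t" if t: "t > 0" for t
  proof -
    have t0: "t \<ge> 0" and tz: "complex_of_real (t + z) \<noteq> 0" using t z by (auto simp flip: of_real_add)
    have "summable (\<lambda>n. norm (pcA z t (b + 1) n))"
      using b by (intro summable_pcA z t0) auto
    then obtain s where s: "pcA z t (b + 1) sums s"
      using summable_norm_cancel summable_sums by blast
    have e: "b + 2 - 1 = b + 1" "b + 2 - 2 = b" by simp_all
    have "(\<lambda>n. of_real ((b + 2) - 1) * pcA z t ((b + 2) - 2) n) sums (of_real (t + z) * s)"
      by (rule pcA_sums_lower[OF z t0 _ disjI2]) (use b s in \<open>simp_all only: e\<close>)
    moreover have "(\<lambda>n. of_real (b + 1) * pcA z t b n) sums (of_real (b + 1) * U t)"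
      by (intro sums_mult U t0)
    ultimately have "of_real (t + z) * s = of_real (b + 1) * U t"
      unfolding e by (rule sums_unique2)
    then have s': "s = of_real ((b + 1) / (t + z)) * U t"
      using tz by (simp add: field_simps)
    have "(\<lambda>n. of_real (t / 2) * pcA z t b n - pcA z t (b + 1) n) sums (of_real (t / 2) * U t - s)"
      by (intro sums_diff sums_mult U t0 s)
    moreover have "of_real (t / 2) * pcA z t b n - pcA z t (b + 1) n = \<alpha> n * pcD' (of_real b + of_nat n) t" for n
      by (simp add: pcA_def \<alpha>_def pcD'_def algebra_simps)
    ultimately have "U' t = of_real (t / 2) * U t - s" by (simp add: U'_def sums_iff)
    then show ?thesis by (simp only: s' left_diff_distrib)
  qed
  \<comment> \<open>The reciprocal of a nonzero solution of the first order equation, hence \<phi> U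
    is constant. As \<phi> tends to 0 and U is bounded, the constant is 0.\<close>
  define \<phi> where "\<phi> = (\<lambda>t. (t + z) powr (b + 1) * exp (- (t ^ 2) / 4))"
  have \<phi>: "(\<phi> has_real_derivative \<phi> t * ((b + 1) / (t + z) - t / 2)) (at t)" if "t > 0" for t
  proof -
    have "(t + z) powr b = (t + z) powr (b + 1) / (t + z)"
      using that z by (simp add: powr_add)
    then show ?thesis
      unfolding \<phi>_def using that z
      by (auto intro!: derivative_eq_intros simp: algebra_simps)
  qed
  have "((\<lambda>t. of_real (\<phi> t) * U t) has_vector_derivative 0) (at t within {0<..})" if t: "t \<in> {0<..}" for t
  proof -
    have "((\<lambda>t. complex_of_real (\<phi> t)) has_vector_derivative of_real (\<phi> t * ((b + 1) / (t + z) - t / 2))) (at t)"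
      using \<phi>[of t] t by (intro has_vector_derivative_of_real) auto
    from has_vector_derivative_mult[OF this has_vector_derivative_U[of t]]
    have "((\<lambda>t. of_real (\<phi> t) * U t) has_vector_derivative
        of_real (\<phi> t) * U' t + of_real (\<phi> t * ((b + 1) / (t + z) - t / 2)) * U t) (at t)"
      using t by simp
    also have "of_real (\<phi> t) * U' t + of_real (\<phi> t * ((b + 1) / (t + z) - t / 2)) * U t = 0"
      using t by (simp add: U' algebra_simps)
    finally show ?thesis by (rule has_vector_derivative_at_within)
  qed
  then obtain c where c: "\<And>t. t \<in> {0<..} \<Longrightarrow> of_real (\<phi> t) * U t = c"
    using has_vector_derivative_zero_constant[of "{0<..}" "\<lambda>t. of_real (\<phi> t) * U t"] by (metis convex_real_interval(3))
  define B where "B = (\<Sum>n. norm (\<alpha> n) * pcD_sup (of_real b + of_nat n))"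
  have "((\<lambda>t. \<phi> t * B) \<longlongrightarrow> 0) at_top"
  proof -
    have "(\<phi> \<longlongrightarrow> 0) at_top" unfolding \<phi>_def using b by real_asymp
    then show ?thesis by (rule tendsto_mult_left_zero)
  qed
  moreover have "\<forall>\<^sub>F t in at_top. norm c \<le> \<phi> t * B"
    using eventually_gt_at_top[of 0]
  proof eventually_elim
    case (elim t)
    have "norm c = \<phi> t * norm (U t)"
      using c[of t] elim by (auto simp: norm_mult \<phi>_def)
    also have "\<dots> \<le> \<phi> t * B"
      using norm_U_le[of t] elim by (intro mult_left_mono) (auto simp: B_def \<phi>_def)
    finally show ?case .
  qed
  ultimately have "norm c \<le> 0"
    by (intro tendsto_lowerbound) auto
  then have U0: "U t = 0" if "t \<in> {0<..}" for t
    using c[OF that] that z by (auto simp: \<phi>_def)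
  \<comment> \<open>The equation is used only for positive arguments, being singular at 0 when z =
    0; the value at y = 0 follows by continuity.\<close>
  have cl: "closure {0<..} = {0::real..}" by simp
  have "U y = 0"
    by (rule continuous_constant_on_closure[of "{0<..}" U 0 y, unfolded cl, OF continuous_on_U U0]) (use y in auto)
  then show ?thesis using U[OF y] by simp
qed

text \<open>At b + 1 \<open>pcA_sums_lower\<close> reads (y + z) G(b) = b G(b - 1), so vanishing
  passes from b - 1 to b while the sum at b converges. At y = z = 0 this says nothing; there the
  same lemma at b + 2 gives (b + 1) G(b) = 0.\<close>

lemma pcA_sums_0:
  assumes z: "z \<ge> 0" and y: "y \<ge> 0" and b: "b < -1"
  shows "pcA z y b sums 0"
proof -
  have "\<forall>b. b < -1 \<longrightarrow> b < real k - 5 \<longrightarrow> pcA z y b sums 0" for k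
  proof (induction k)
    case 0
    then show ?case using pcA_sums_0_aux[OF z y] by auto
  next
    case (Suc k)
    show ?case
    proof (intro allI impI)
      fix b :: real assume b: "b < -1" "b < real (Suc k) - 5"
      show "pcA z y b sums 0"
      proof (cases "y + z = 0")
        case True
        then have "(\<lambda>n. of_real ((b + 2) - 1) * pcA z y ((b + 2) - 2) n) sums (of_real (y + z) * 0)"
          using b by (intro pcA_sums_lower z y) auto
        moreover have "b + 2 - 1 = b + 1" "b + 2 - 2 = b" by simp_all
        ultimately have "(\<lambda>n. of_real (b + 1) * pcA z y b n) sums (of_real (b + 1) * 0)"
          using True by (simp only: of_real_0 mult_zero_left mult_zero_right)
        moreover have "of_real (b + 1) \<noteq> (0::complex)" using b by (simp only: of_real_eq_0_iff)
        ultimately show ?thesis by (subst (asm) sums_mult_iff) auto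
      next
        case False
        have "summable (\<lambda>n. norm (pcA z y b n))"
          by (intro summable_pcA z y b)
        then obtain s where s: "pcA z y b sums s"
          using summable_norm_cancel summable_sums by blast
        have "(\<lambda>n. of_real ((b + 1) - 1) * pcA z y ((b + 1) - 2) n) sums (of_real (y + z) * s)"
          using b s by (intro pcA_sums_lower z y) auto
        moreover have "(\<lambda>n. of_real b * pcA z y (b - 1) n) sums (of_real b * 0)"
          using b by (intro sums_mult Suc.IH[rule_format]) auto
        ultimately have "of_real (y + z) * s = 0" by (simp add: sums_iff)
        then have "s = 0" using False by (metis mult_eq_0_iff of_real_eq_0_iff)
        then show ?thesis using s by simp
      qed
    qed
  qed
  moreover obtain k where "b + 5 < real k" using reals_Archimedean2 by blast
  ultimately show ?thesis using b by (metis less_diff_eq)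
qed

lemma weight_bigo: "(\<lambda>n. norm (1 / (of_nat n + \<nu> :: complex))) \<in> O(\<lambda>_. 1)"
proof (rule bigoI[of _ 1])
  have "\<forall>\<^sub>F n in sequentially. real n \<ge> 1 - Re \<nu>" by real_asymp
  then show "\<forall>\<^sub>F n in sequentially. norm (norm (1 / (of_nat n + \<nu>))) \<le> 1 * norm (1::real)"
  proof eventually_elim
    case (elim n)
    then have "1 \<le> Re (of_nat n + \<nu>)" by simp
    also have "\<dots> \<le> norm (of_nat n + \<nu>)" by (rule complex_Re_le_cmod)
    finally show ?case by (simp add: norm_divide divide_le_eq_1)
  qed
qed

text \<open>The value at the origin is carried along z with y = 0, then along y with z fixed. In
  both directions the factor n + \<nu> cancels the weight, so the hypothesis \<open>zero\<close> of
  \<open>U_proportional\<close> is just G = 0.\<close>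

lemma pcA_series_base:
  assumes z: "z \<ge> 0" and y: "y \<ge> 0" and b: "b < -5" and \<nu>: "Re \<nu> > 1"
  shows "(\<lambda>n. pcA z y b n / (of_nat n + \<nu>)) sums (Gamma \<nu> * pcD (- \<nu>) z * pcD (of_real b - \<nu>) y)"
proof -
  define T where "T = (\<lambda>z y. \<Sum>n. pcA z y b n / (of_nat n + \<nu>))"
  have nz: "of_nat n + \<nu> \<noteq> 0" for n using \<nu> by (auto simp: complex_eq_iff)
  note w = weight_bigo[of \<nu>]
  have sum_T: "(\<lambda>n. pcA z y b n / (of_nat n + \<nu>)) sums T z y" if z: "z \<ge> 0" and y: "y \<ge> 0" for z y
  proof -
    interpret pcD_series "\<lambda>n. 1 / (of_nat n + \<nu>) * ((-1) ^ n / fact n * pcD (of_nat n) z)" b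
      by (rule pcD_series_y(1)[OF z b w])
    show ?thesis using summable_sums[OF summable_U[OF y]] by (simp add: T_def pcA_def mult_ac)
  qed
  have Ty: "T z y * pcD (of_real b - \<nu>) 0 = T z 0 * pcD (of_real b - \<nu>) y"
    if z: "z \<ge> 0" and y: "y \<ge> 0" for z y
  proof -
    interpret pcD_series "\<lambda>n. 1 / (of_nat n + \<nu>) * ((-1) ^ n / fact n * pcD (of_nat n) z)" b
      by (rule pcD_series_y(1)[OF z b w])
    have U: "U t = T z t" for t unfolding U_def T_def pcA_def by (simp add: mult_ac)
    have "U y * pcD (of_real b - \<nu>) 0 = U 0 * pcD (of_real b - \<nu>) y"
    proof (rule U_proportional[OF pcD_series_y(2)[OF z b w] _ _ y])
      fix t :: real assume "t > 0"
      then have "pcA z t b sums 0" using b by (intro pcA_sums_0 z) auto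
      moreover have "(\<lambda>n. (of_nat n + \<nu>) * (1 / (of_nat n + \<nu>) * ((-1) ^ n / fact n * pcD (of_nat n) z) * pcD (of_real b + of_nat n) t)) = pcA z t b"
        using nz by (auto simp: pcA_def)
      ultimately show "(\<lambda>n. (of_nat n + \<nu>) * (1 / (of_nat n + \<nu>) * ((-1) ^ n / fact n * pcD (of_nat n) z) * pcD (of_real b + of_nat n) t)) sums 0"
        by simp
    qed (use b \<nu> in auto)
    then show ?thesis unfolding U by simp
  qed
  have Tz: "T z y * pcD (- \<nu>) 0 = T 0 y * pcD (- \<nu>) z"
    if z: "z \<ge> 0" and y: "y \<ge> 0" for z y
  proof -
    interpret pcD_series "\<lambda>n. 1 / (of_nat n + \<nu>) * ((-1) ^ n / fact n * pcD (of_real b + of_nat n) y)" 0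
      by (rule pcD_series_z(1)[OF y b w])
    have U: "U t = T t y" for t unfolding U_def T_def pcA_def by (simp add: mult_ac)
    have "U z * pcD (of_real 0 - \<nu>) 0 = U 0 * pcD (of_real 0 - \<nu>) z"
    proof (rule U_proportional[OF pcD_series_z(2)[OF y b w] _ _ z])
      fix t :: real assume "t > 0"
      then have "pcA t y b sums 0" using b by (intro pcA_sums_0 y) auto
      moreover have "(\<lambda>n. (of_nat n + \<nu>) * (1 / (of_nat n + \<nu>) * ((-1) ^ n / fact n * pcD (of_real b + of_nat n) y) * pcD (of_real 0 + of_nat n) t)) = pcA t y b"
        using nz by (auto simp: pcA_def)
      ultimately show "(\<lambda>n. (of_nat n + \<nu>) * (1 / (of_nat n + \<nu>) * ((-1) ^ n / fact n * pcD (of_real b + of_nat n) y) * pcD (of_real 0 + of_nat n) t)) sums 0"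
        by simp
    qed (use \<nu> in auto)
    then show ?thesis unfolding U by simp
  qed
  have D: "pcD (of_real b - \<nu>) 0 \<noteq> 0" "pcD (- \<nu>) 0 \<noteq> 0"
    using b \<nu> by (auto intro!: pcD_0_nonzero)
  have T0: "T 0 0 = Gamma \<nu> * pcD (- \<nu>) 0 * pcD (of_real b - \<nu>) 0"
    using pcA_series_at_0[OF _ \<nu>, of b] b by (simp add: T_def sums_iff)
  have "T z 0 = Gamma \<nu> * pcD (- \<nu>) z * pcD (of_real b - \<nu>) 0"
    using Tz[OF z order_refl] D(2) unfolding T0 by (simp add: mult_ac)
  then have "T z y = Gamma \<nu> * pcD (- \<nu>) z * pcD (of_real b - \<nu>) y"
    using Ty[OF z y] D(1) by (simp add: mult_ac)
  then show ?thesis using sum_T[OF z y] by simp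
qed

text \<open>In the y-recurrence b + n - 1 = (b - 1 - \<nu>) + (n + \<nu>). After division by n +
  \<nu> the second part leaves A_n(b - 2), whose sum is 0 because b - 2 < -1; the rest is the
  recurrence of D_(b-\<nu>)(y).\<close>

lemma pcA_series_raise:
  assumes z: "z \<ge> 0" and y: "y \<ge> 0" and \<nu>: "\<nu> \<notin> \<int>\<^sub>\<le>\<^sub>0"
    and low: "\<And>b. b < m \<Longrightarrow> (\<lambda>n. pcA z y b n / (of_nat n + \<nu>)) sums (Gamma \<nu> * pcD (- \<nu>) z * pcD (of_real b - \<nu>) y)"
    and b: "b < 1"
  shows "(\<lambda>n. pcA z y b n / (of_nat n + \<nu>)) sums (Gamma \<nu> * pcD (- \<nu>) z * pcD (of_real b - \<nu>) y)"
proof -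
  let ?P = "\<lambda>b. (\<lambda>n. pcA z y b n / (of_nat n + \<nu>)) sums (Gamma \<nu> * pcD (- \<nu>) z * pcD (of_real b - \<nu>) y)"
  have nz: "of_nat n + \<nu> \<noteq> 0" for n
    using \<nu> plus_of_nat_eq_0_imp[of \<nu> n] by (auto simp: add.commute)
  have "\<forall>b<1. b < m + real k \<longrightarrow> ?P b" for k
  proof (induction k)
    case 0
    then show ?case using low by simp
  next
    case (Suc k)
    show ?case
    proof (intro allI impI)
      fix b :: real assume b: "b < 1" "b < m + real (Suc k)"
      have 1: "?P (b - 1)" and 2: "?P (b - 2)"
        by (rule Suc.IH[rule_format]; use b in simp)+
      have 3: "pcA z y (b - 2) sums 0" using b by (intro pcA_sums_0 z y) auto
      have "(\<lambda>n. of_real y * (pcA z y (b - 1) n / (of_nat n + \<nu>)) - (of_real (b - 1) - \<nu>) * (pcA z y (b - 2) n / (of_nat n + \<nu>)) - pcA z y (b - 2) n)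
         sums (of_real y * (Gamma \<nu> * pcD (- \<nu>) z * pcD (of_real (b - 1) - \<nu>) y)
            - (of_real (b - 1) - \<nu>) * (Gamma \<nu> * pcD (- \<nu>) z * pcD (of_real (b - 2) - \<nu>) y) - 0)"
        by (intro sums_diff sums_mult 1 2 3)
      moreover have "of_real y * (pcA z y (b - 1) n / (of_nat n + \<nu>)) - (of_real (b - 1) - \<nu>) * (pcA z y (b - 2) n / (of_nat n + \<nu>)) - pcA z y (b - 2) n
         = pcA z y b n / (of_nat n + \<nu>)" for n
      proof -
        define d where "d = of_nat n + \<nu>"
        define p where "p = pcA z y (b - 1) n / d"
        define q where "q = pcA z y (b - 2) n / d"
        have d: "d \<noteq> 0" using nz[of n] by (simp add: d_def)
        then have A: "pcA z y (b - 1) n = d * p" "pcA z y (b - 2) n = d * q" by (simp_all add: p_def q_def)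
        have "pcA z y b n = d * (of_real y * p - (of_real b + of_nat n - 1) * q)"
          unfolding pcA_y_recurrence[of z y b n] A by (simp add: algebra_simps)
        then have "pcA z y b n / d = of_real y * p - (of_real b + of_nat n - 1) * q" using d by simp
        also have "\<dots> = of_real y * p - (of_real (b - 1) - \<nu>) * q - d * q"
          by (simp add: d_def algebra_simps)
        finally show ?thesis
          unfolding d_def[symmetric] p_def[symmetric] q_def[symmetric] A(2) using d by simp
      qed
      moreover have "of_real y * (Gamma \<nu> * pcD (- \<nu>) z * pcD (of_real (b - 1) - \<nu>) y)
            - (of_real (b - 1) - \<nu>) * (Gamma \<nu> * pcD (- \<nu>) z * pcD (of_real (b - 2) - \<nu>) y) - 0
          = Gamma \<nu> * pcD (- \<nu>) z * pcD (of_real b - \<nu>) y"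
      proof -
        have "pcD (of_real b - \<nu>) y = of_real y * pcD (of_real (b - 1) - \<nu>) y - (of_real (b - 1) - \<nu>) * pcD (of_real (b - 2) - \<nu>) y"
          using pcD_recurrence[of "of_real (b - 1) - \<nu>" y] by (simp add: algebra_simps)
        then show ?thesis by (simp only: right_diff_distrib mult_ac) simp
      qed
      ultimately show "?P b" by simp
    qed
  qed
  moreover obtain k where "b - m < real k" using reals_Archimedean2 by blast
  then have "b < m + real k" by simp
  ultimately show ?thesis using b by blast
qed

text \<open>Divided by n + 1 + \<nu>, the z-recurrence at b + 1 expresses the sum of n A_n(b)/(n +
  \<nu>) through the expansions at (\<nu> + 1, b + 1) and (\<nu> + 2, b + 2). Since n/(n + \<nu>) =
  1 - \<nu>/(n + \<nu>) and G = 0, this determines \<nu> T. The expansion at b + 2 restricts the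
  step to b < -1, and \<open>pcA_series_raise\<close> recovers all b < 1.\<close>

lemma pcA_series_nonpole:
  assumes z: "z \<ge> 0" and y: "y \<ge> 0" and \<nu>: "\<nu> \<notin> \<int>\<^sub>\<le>\<^sub>0" and b: "b < 1"
  shows "(\<lambda>n. pcA z y b n / (of_nat n + \<nu>)) sums (Gamma \<nu> * pcD (- \<nu>) z * pcD (of_real b - \<nu>) y)"
proof -
  let ?P = "\<lambda>\<nu> b. (\<lambda>n. pcA z y b n / (of_nat n + \<nu>)) sums (Gamma \<nu> * pcD (- \<nu>) z * pcD (of_real b - \<nu>) y)"
  have "\<forall>\<nu>. \<nu> \<notin> \<int>\<^sub>\<le>\<^sub>0 \<longrightarrow> Re \<nu> > 1 - real k \<longrightarrow> (\<forall>b<1. ?P \<nu> b)" for k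
  proof (induction k)
    case 0
    show ?case
      using pcA_series_raise[OF z y, where m = "-5"] pcA_series_base[OF z y] by auto
  next
    case (Suc k)
    show ?case
    proof (intro allI impI)
      fix \<nu> :: complex and b :: real assume \<nu>: "\<nu> \<notin> \<int>\<^sub>\<le>\<^sub>0" "Re \<nu> > 1 - real (Suc k)" and "b < 1"
      have \<nu>1: "\<nu> + 1 \<notin> \<int>\<^sub>\<le>\<^sub>0" "\<nu> + 2 \<notin> \<int>\<^sub>\<le>\<^sub>0"
        using \<nu>(1) nonpos_Ints_diff_Nats[of "\<nu> + 1" 1] nonpos_Ints_diff_Nats[of "\<nu> + 2" 2] by auto
      have nz: "\<nu> \<noteq> 0" using \<nu>(1) by auto
      show "?P \<nu> b"
      proof (rule pcA_series_raise[OF z y \<nu>(1) _ \<open>b < 1\<close>])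
        fix b :: real assume b: "b < -1"
        have b1: "b + 1 < 1" "b + 1 + 1 < 1" using b by auto
        have \<nu>2: "Re (\<nu> + 1) > 1 - real k" "Re (\<nu> + 2) > 1 - real k" using \<nu>(2) by auto
        have 0: "pcA z y b sums 0" by (rule pcA_sums_0[OF z y b])
        have 1: "?P (\<nu> + 1) (b + 1)" using Suc.IH \<nu>1 \<nu>2 b1 by blast
        have 2: "?P (\<nu> + 2) (b + 1 + 1)" using Suc.IH \<nu>1 \<nu>2 b1 by blast
        define X where "X = of_real z * (Gamma (\<nu> + 1) * pcD (- (\<nu> + 1)) z * pcD (of_real (b + 1) - (\<nu> + 1)) y)
           + Gamma (\<nu> + 2) * pcD (- (\<nu> + 2)) z * pcD (of_real (b + 1 + 1) - (\<nu> + 2)) y"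
        have nn: "of_nat n + \<nu> \<noteq> 0" for n
          using \<nu>(1) plus_of_nat_eq_0_imp[of \<nu> n] by (auto simp: add.commute)
        have "(\<lambda>n. of_real z * (pcA z y (b + 1) n / (of_nat n + (\<nu> + 1)))
              + pred_seq (\<lambda>n. pcA z y (b + 1 + 1) n / (of_nat n + (\<nu> + 2))) n) sums X"
          unfolding X_def by (intro sums_add sums_mult 1 sums_pred_seq 2)
        moreover have "of_real z * (pcA z y (b + 1) n / (of_nat n + (\<nu> + 1)))
              + pred_seq (\<lambda>n. pcA z y (b + 1 + 1) n / (of_nat n + (\<nu> + 2))) n
            = - (of_nat (Suc n) * pcA z y b (Suc n) / (of_nat (Suc n) + \<nu>))" for n
        proof -
          \<comment> \<open>The predecessor has index n - 1, so with \<nu> + 2 its denominator is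
            again n + 1 + \<nu>.\<close>
          have p: "pred_seq (\<lambda>n. pcA z y (b + 1 + 1) n / (of_nat n + (\<nu> + 2))) n
              = pred_seq (pcA z y (b + 1 + 1)) n / (of_nat (Suc n) + \<nu>)"
            by (cases n) (simp_all add: add_ac)
          have e: "of_nat n + (\<nu> + 1) = of_nat (Suc n) + \<nu>" by simp
          show ?thesis
            unfolding p e times_divide_eq_right pcA_z_recurrence[of z y "b + 1" n] add_divide_distrib[symmetric]
            by (simp del: of_nat_Suc)
        qed
        ultimately have "(\<lambda>n. - (of_nat (Suc n) * pcA z y b (Suc n) / (of_nat (Suc n) + \<nu>))) sums X" by simp
        \<comment> \<open>The term of index 0 vanishes through its factor n, so the unshifted series
          has the same sum.\<close>
        then have "(\<lambda>n. - (of_nat n * pcA z y b n / (of_nat n + \<nu>))) sums X"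
          using sums_Suc_iff[of "\<lambda>n. - (of_nat n * pcA z y b n / (of_nat n + \<nu>))" X] by simp
        from sums_add[OF 0 this]
        have "(\<lambda>n. pcA z y b n + - (of_nat n * pcA z y b n / (of_nat n + \<nu>))) sums X" by simp
        moreover have "pcA z y b n + - (of_nat n * pcA z y b n / (of_nat n + \<nu>)) = \<nu> * (pcA z y b n / (of_nat n + \<nu>))" for n
          using nn[of n] by (simp add: field_simps)
        ultimately have "(\<lambda>n. \<nu> * (pcA z y b n / (of_nat n + \<nu>))) sums X" by simp
        moreover have "X = \<nu> * (Gamma \<nu> * pcD (- \<nu>) z * pcD (of_real b - \<nu>) y)"
        proof -
          have G: "Gamma (\<nu> + 1) = \<nu> * Gamma \<nu>" "Gamma (\<nu> + 2) = (\<nu> + 1) * (\<nu> * Gamma \<nu>)"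
            using Gamma_plus1[OF \<nu>(1)] Gamma_plus1[OF \<nu>1(1)] by (simp_all add: add.assoc)
          have D: "pcD (- \<nu>) z = of_real z * pcD (- (\<nu> + 1)) z + (\<nu> + 1) * pcD (- (\<nu> + 2)) z"
            using pcD_recurrence[of "- (\<nu> + 1)" z] by (simp add: algebra_simps)
          have e: "of_real (b + 1) - (\<nu> + 1) = of_real b - \<nu>" "of_real (b + 1 + 1) - (\<nu> + 2) = of_real b - \<nu>"
            by simp_all
          show ?thesis unfolding X_def G D e by (simp only: ring_distribs mult_ac)
        qed
        ultimately have "(\<lambda>n. \<nu> * (pcA z y b n / (of_nat n + \<nu>))) sums (\<nu> * (Gamma \<nu> * pcD (- \<nu>) z * pcD (of_real b - \<nu>) y))"
          by (simp only:)
        then show "?P \<nu> b" using sums_mult_iff[OF nz] by blast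
      qed
    qed
  qed
  moreover obtain k where "1 - Re \<nu> < real k" using reals_Archimedean2 by blast
  then have "Re \<nu> > 1 - real k" by simp
  ultimately show ?thesis using b \<nu> by blast
qed

section \<open>The coefficients at the poles, and the theorem\<close>

lemma Gamma_coeff_nonpole: "\<nu> \<notin> \<int>\<^sub>\<le>\<^sub>0 \<Longrightarrow> Gamma_coeff \<nu> n = 1 / (Gamma \<nu> * (of_nat n + \<nu>))"
  by (simp add: Gamma_coeff_def)

text \<open>For n = m the expression is the difference quotient of \<open>rGamma\<close> at its zero
  -m, with limit the derivative there. For other n it is continuous at -m and has the value
  0.\<close>

lemma Gamma_coeff_pole: "Gamma_coeff (- of_nat m) n = (if n = m then (-1) ^ m * fact m else 0)"
proof -
  have eq: "(\<lambda>w. 1 / (Gamma w * (of_nat n + w))) = (\<lambda>w. rGamma w / (of_nat n + w))" for n :: nat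
    by (auto simp: rGamma_inverse_Gamma field_simps)
  have "((\<lambda>w. rGamma w / (of_nat n + w)) \<longlongrightarrow> (if n = m then (-1) ^ m * fact m else 0)) (at (- of_nat m :: complex))"
  proof (cases "n = m")
    case True
    have "(rGamma has_field_derivative (-1) ^ m * fact m) (at (- of_nat m :: complex))"
      by (rule has_field_derivative_rGamma_nonpos_int)
    then show ?thesis
      using True by (simp add: has_field_derivative_iff add.commute)
  next
    case False
    then have "of_nat n + - of_nat m \<noteq> (0::complex)" by simp
    then have "isCont (\<lambda>w. rGamma w / (of_nat n + w)) (- of_nat m :: complex)"
      by (intro continuous_intros) auto
    then show ?thesis using False by (simp add: isCont_def)
  qed
  then show ?thesis
    unfolding Gamma_coeff_def eq by (simp add: tendsto_Lim)
qed

theorem mainTheorem7: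
  fixes \<nu> :: complex and \<mu> z :: real
  assumes "\<mu> < 3 / 2" and "z \<ge> 0"
  shows "(\<lambda>n. Gamma_coeff \<nu> n *
            ((-1) ^ n * parabolic_cylinder_D (of_nat n) (of_real z)
               * parabolic_cylinder_D (of_real \<mu> + of_nat n - 1) (of_real z) / fact n))
         sums (parabolic_cylinder_D (- \<nu>) (of_real z)
               * parabolic_cylinder_D (of_real \<mu> - \<nu> - 1) (of_real z))"
proof -
  have A: "(-1) ^ n * parabolic_cylinder_D (of_nat n) (of_real z)
      * parabolic_cylinder_D (of_real \<mu> + of_nat n - 1) (of_real z) / fact n = pcA z z (\<mu> - 1) n" for n
    by (simp add: pcA_def pcD_def diff_add_eq)
  have D: "parabolic_cylinder_D (- \<nu>) (of_real z) * parabolic_cylinder_D (of_real \<mu> - \<nu> - 1) (of_real z)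
      = pcD (- \<nu>) z * pcD (of_real (\<mu> - 1) - \<nu>) z"
  proof -
    have "of_real \<mu> - \<nu> - 1 = of_real (\<mu> - 1) - \<nu>" by simp
    then show ?thesis by (simp only: pcD_def)
  qed
  show ?thesis unfolding A D
  proof (cases "\<nu> \<in> \<int>\<^sub>\<le>\<^sub>0")
    case False
    then have G: "Gamma \<nu> \<noteq> 0" by (simp add: Gamma_eq_zero_iff)
    have "(\<lambda>n. 1 / Gamma \<nu> * (pcA z z (\<mu> - 1) n / (of_nat n + \<nu>))) sums
        (1 / Gamma \<nu> * (Gamma \<nu> * pcD (- \<nu>) z * pcD (of_real (\<mu> - 1) - \<nu>) z))"
      using assms False by (intro sums_mult pcA_series_nonpole) auto
    then show "(\<lambda>n. Gamma_coeff \<nu> n * pcA z z (\<mu> - 1) n) sums (pcD (- \<nu>) z * pcD (of_real (\<mu> - 1) - \<nu>) z)"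
      using G by (simp add: Gamma_coeff_nonpole[OF False])
  next
    case True
    then obtain m where m: "\<nu> = - of_nat m" by (elim nonpos_Ints_cases')
    \<comment> \<open>Only n = m survives; its coefficient (-1)^m m! cancels (-1)^m/m! in A_m, and
      the orders m and b + m are already -\<nu> and b - \<nu>.\<close>
    have "(\<lambda>n. if n = m then (-1) ^ m * fact m * pcA z z (\<mu> - 1) n else 0) sums ((-1) ^ m * fact m * pcA z z (\<mu> - 1) m)"
      by (rule sums_single)
    also have "(\<lambda>n. if n = m then (-1) ^ m * fact m * pcA z z (\<mu> - 1) n else 0) = (\<lambda>n. Gamma_coeff \<nu> n * pcA z z (\<mu> - 1) n)"
      by (auto simp: m Gamma_coeff_pole)
    also have "(-1) ^ m * fact m * pcA z z (\<mu> - 1) m = pcD (- \<nu>) z * pcD (of_real (\<mu> - 1) - \<nu>) z"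
      by (simp add: m pcA_def flip: power_mult_distrib)
    finally show "(\<lambda>n. Gamma_coeff \<nu> n * pcA z z (\<mu> - 1) n) sums (pcD (- \<nu>) z * pcD (of_real (\<mu> - 1) - \<nu>) z)" .
  qed
qed

end
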